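(* Let $X$ be a regular Feller process of the spectrally negative type with infinite lifetime on an interval $E\subseteq\mathbb{R}$, let $q>0$, let $g,c:E\to[0,\infty)$ be continuous, and put $C_t=\int_0^t c(X_s)e^{-qs}\,ds$ for $t\in[0,\infty]$ and $\delta(y)=\mathbb{E}_y[C_\infty]$ for $y\in E$, assumed finite on $E$. Let $h_q^+$ be the increasing function on $E$ satisfying $\mathbb{E}_y[e^{-qT_z}]=h_q^+(y)/h_q^+(z)$ for all $y\le z$ in $E$. Let $x\in E$ and assume that $$D^*:=\sup_{u\in E}\frac{g(u)+\delta(u)}{h_q^+(u)}=\sup_{u\in E,\ u\ge x}\frac{g(u)+\delta(u)}{h_q^+(u)}<\infty .$$ Then $$\sup_{T\in\Sigma_\infty^X}\mathbb{E}_x\big[e^{-qT}g(X_T)-C_T\big]=D^*\,h_q^+(x)-\delta(x).$$ If moreover there exists a point $u^*\in E$, $u^*\ge x$, such that $D^*=\dfrac{g(u^* )+\delta(u^* )}{h_q^+(u^* )}$, then the optimal stopping time, i.e. a stopping time attaining the supremum on the left, is $$T_{u^*}=\inf\{t>0:\ X_t\ge u^*\}.$$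
   Context: $X=(X_t)_{t\ge0}$ is the càdlàg modification of a Feller process on a filtered probability space $(\Omega,\mathcal{F},(\mathcal{F}_t)_{t\ge0},\mathbb{P})$ with values in an interval $E\subseteq\mathbb{R}$ and infinite lifetime; $\mathbb{P}_x$ is its law started from $x$ and $\mathbb{E}_x$ the expectation. Spectrally negative means that there are no positive jumps: $\mathbb{P}_x(\sup_{t\ge0}(X_t-X_{t-})>0)=0$ for all $x\in E$. Regular means $\mathbb{P}_x(T_y<\infty)>0$ for all $x,y\in E$, where $T_y=\inf\{t>0:X_t=y\}$, and that each point is regular for itself, $\mathbb{P}_x(T_x=0)=1$ (so that $X$ admits a local time at each point). For such processes there is, for each $q>0$, an increasing left-continuous function $h_q^+$ on $E$, unique up to a positive multiplicative constant, with values in $(0,\infty)$, such that $\mathbb{E}_y[e^{-qT_z}]=h_q^+(y)/h_q^+(z)$ for all $y\le z$ in $E$; it is $q$-excessive for $X$, i.e. $e^{-qt}\mathbb{E}_y[h_q^+(X_t)]\le h_q^+(y)$ for all $t>0$, with convergence to $h_q^+(y)$ as $t\downarrow0$. $\Sigma_\infty^X$ is the set of all $(\mathcal{F}_t)$-stopping times (values in $[0,\infty]$), and $e^{-qT}g(X_T)$ is taken to be $0$ on $\{T=\infty\}$. *)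

theory Defs
  imports "HOL-Probability.Probability"
begin

text \<open>Continuous functions on \<open>E\<close> vanishing at infinity; functions are total, only their values
  on \<open>E\<close> matter.\<close>

definition C0 :: "real set \<Rightarrow> (real \<Rightarrow> real) set" where
  "C0 E = {f. continuous_on E f \<and>
     (\<forall>e>0. \<exists>K\<subseteq>E. compact K \<and> (\<forall>x\<in>E - K. \<bar>f x\<bar> < e))}"

text \<open>A cadlag Feller process with infinite lifetime on the interval \<open>E\<close>, given as the family of
  laws \<open>P x\<close>, \<open>x \<in> E\<close>, on one filtered space.  The process \<open>X\<close> is only considered at times
  \<open>t \<ge> 0\<close>.  The filtration is indexed by \<open>[0,\<infinity>]\<close>, so that the library's \<open>stopping_time\<close> covers
  stopping times with values in \<open>[0,\<infinity>]\<close>; its value at \<open>\<infinity>\<close> is not further constrained.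
  The filtration satisfies the usual conditions: it is right-continuous, and \<open>F 0\<close> contains every
  subset of an event that is null under all the laws \<open>P x\<close>.
  Infinite lifetime means that \<open>X\<close> stays in \<open>E\<close>, that is, the transition semigroup
  \<open>f \<mapsto> (\<lambda>y. \<integral>\<omega>. f (X t \<omega>) \<partial>P y)\<close> is conservative.\<close>

locale feller_process = filtration "space M" F
  for M :: "'a measure" and F :: "ennreal \<Rightarrow> 'a measure" +
  fixes E :: "real set" and P :: "real \<Rightarrow> 'a measure" and X :: "real \<Rightarrow> 'a \<Rightarrow> real"
  assumes interval: "is_interval E" "E \<noteq> {}"
    and sets_F: "\<And>t. sets (F t) \<subseteq> sets M"
    and right_continuous: "\<And>t. t < \<infinity> \<Longrightarrow> sets (F t) = (\<Inter>s\<in>{t<..}. sets (F s))"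
    and complete: "\<And>A N. A \<subseteq> N \<Longrightarrow> N \<in> sets M \<Longrightarrow> (\<And>x. x \<in> E \<Longrightarrow> emeasure (P x) N = 0) \<Longrightarrow> A \<in> sets (F 0)"
    and prob_P: "\<And>x. x \<in> E \<Longrightarrow> prob_space (P x)"
    and sets_P: "\<And>x. x \<in> E \<Longrightarrow> sets (P x) = sets M"
    and adapted: "\<And>t. 0 \<le> t \<Longrightarrow> X t \<in> borel_measurable (F (ennreal t))"
    and range_X: "\<And>t \<omega>. 0 \<le> t \<Longrightarrow> \<omega> \<in> space M \<Longrightarrow> X t \<omega> \<in> E"
    and start: "\<And>x. x \<in> E \<Longrightarrow> AE \<omega> in P x. X 0 \<omega> = x"
    and cadlag_right: "\<And>t \<omega>. 0 \<le> t \<Longrightarrow> \<omega> \<in> space M \<Longrightarrow> ((\<lambda>s. X s \<omega>) \<longlongrightarrow> X t \<omega>) (at_right t)"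
    and cadlag_left: "\<And>t \<omega>. 0 < t \<Longrightarrow> \<omega> \<in> space M \<Longrightarrow> \<exists>l\<in>E. ((\<lambda>s. X s \<omega>) \<longlongrightarrow> l) (at_left t)"
    and feller: "\<And>f t. f \<in> C0 E \<Longrightarrow> 0 \<le> t \<Longrightarrow> (\<lambda>y. \<integral>\<omega>. f (X t \<omega>) \<partial>P y) \<in> C0 E"
    and feller_continuous: "\<And>f. f \<in> C0 E \<Longrightarrow>
          uniform_limit E (\<lambda>t y. \<integral>\<omega>. f (X t \<omega>) \<partial>P y) f (at_right 0)"
    and markov: "\<And>f s t x. f \<in> C0 E \<Longrightarrow> 0 \<le> s \<Longrightarrow> 0 \<le> t \<Longrightarrow> x \<in> E \<Longrightarrow>
          AE \<omega> in P x. real_cond_exp (P x) (F (ennreal t)) (\<lambda>\<omega>'. f (X (t + s) \<omega>')) \<omega>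
                        = (\<integral>\<omega>'. f (X s \<omega>') \<partial>P (X t \<omega>))"

text \<open>The jump at time \<open>t\<close>, with the convention that there is no jump at time \<open>0\<close>.\<close>

definition jump :: "(real \<Rightarrow> 'a \<Rightarrow> real) \<Rightarrow> real \<Rightarrow> 'a \<Rightarrow> real" where
  "jump X t \<omega> = (if t = 0 then 0 else X t \<omega> - Lim (at_left t) (\<lambda>s. X s \<omega>))"

definition spectrally_negative ::
  "real set \<Rightarrow> (real \<Rightarrow> 'a measure) \<Rightarrow> (real \<Rightarrow> 'a \<Rightarrow> real) \<Rightarrow> bool" where
  "spectrally_negative E P X \<longleftrightarrow>
     (\<forall>x\<in>E. AE \<omega> in P x. \<not> (SUP t\<in>{0..}. ereal (jump X t \<omega>)) > 0)"

definition first_time :: "(real \<Rightarrow> 'a \<Rightarrow> real) \<Rightarrow> real set \<Rightarrow> 'a \<Rightarrow> ennreal" where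
  "first_time X A \<omega> = Inf (ennreal ` {t. 0 < t \<and> X t \<omega> \<in> A})"

definition regular_process ::
  "real set \<Rightarrow> (real \<Rightarrow> 'a measure) \<Rightarrow> (real \<Rightarrow> 'a \<Rightarrow> real) \<Rightarrow> bool" where
  "regular_process E P X \<longleftrightarrow>
     (\<forall>x\<in>E. \<forall>y\<in>E. measure (P x) {\<omega> \<in> space (P x). first_time X {y} \<omega> < \<infinity>} > 0) \<and>
     (\<forall>x\<in>E. AE \<omega> in P x. first_time X {x} \<omega> = 0)"

text \<open>\<open>exp (- q t)\<close> for \<open>t \<in> [0,\<infinity>]\<close>, with value \<open>0\<close> at \<open>t = \<infinity>\<close>.\<close>

definition discount :: "real \<Rightarrow> ennreal \<Rightarrow> real" where
  "discount q t = (if t = \<infinity> then 0 else exp (- q * enn2real t))"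

text \<open>\<open>h\<close> is a version of the increasing left-continuous function usually written
  \<open>h\<^sub>q\<^sup>+\<close>, which is unique up to a positive multiplicative constant.\<close>

definition increasing_q_function ::
  "real set \<Rightarrow> (real \<Rightarrow> 'a measure) \<Rightarrow> (real \<Rightarrow> 'a \<Rightarrow> real) \<Rightarrow> real \<Rightarrow> (real \<Rightarrow> real) \<Rightarrow> bool" where
  "increasing_q_function E P X q h \<longleftrightarrow>
     mono_on E h \<and>
     (\<forall>y\<in>E. 0 < h y) \<and>
     (\<forall>y\<in>E. continuous (at y within (E \<inter> {..y})) h) \<and>
     (\<forall>y\<in>E. \<forall>z\<in>E. y \<le> z \<longrightarrow> (\<integral>\<omega>. discount q (first_time X {z} \<omega>) \<partial>P y) = h y / h z)"

text \<open>\<open>C\<^sub>t = \<integral>\<^sub>0\<^sup>t c(X\<^sub>s) exp (- q s) ds\<close> for \<open>t \<in> [0,\<infinity>]\<close>, for nonnegative \<open>c\<close>.\<close>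

definition cost ::
  "(real \<Rightarrow> 'a \<Rightarrow> real) \<Rightarrow> real \<Rightarrow> (real \<Rightarrow> real) \<Rightarrow> ennreal \<Rightarrow> 'a \<Rightarrow> ennreal" where
  "cost X q c t \<omega> =
     (\<integral>\<^sup>+s. ennreal (c (X s \<omega>) * exp (- q * s)) * indicator {s. 0 \<le> s \<and> ennreal s \<le> t} s \<partial>lborel)"

definition total_cost ::
  "(real \<Rightarrow> 'a measure) \<Rightarrow> (real \<Rightarrow> 'a \<Rightarrow> real) \<Rightarrow> real \<Rightarrow> (real \<Rightarrow> real) \<Rightarrow> real \<Rightarrow> ennreal" where
  "total_cost P X q c y = (\<integral>\<^sup>+\<omega>. cost X q c \<infinity> \<omega> \<partial>P y)"

text \<open>If \<open>total_cost\<close> is finite, then \<open>cost\<close> is finite almost surely, so that \<open>enn2real\<close> loses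
  nothing below.\<close>

definition payoff ::
  "(real \<Rightarrow> 'a \<Rightarrow> real) \<Rightarrow> real \<Rightarrow> (real \<Rightarrow> real) \<Rightarrow> (real \<Rightarrow> real) \<Rightarrow> ('a \<Rightarrow> ennreal) \<Rightarrow> 'a \<Rightarrow> real" where
  "payoff X q g c T \<omega> =
     discount q (T \<omega>) * g (X (enn2real (T \<omega>)) \<omega>) - enn2real (cost X q c (T \<omega>) \<omega>)"

end

theory Submission
  imports Defs
begin

text \<open>The strong Markov property at \<open>T\<close> turns the running cost into a terminal reward: the
  expected payoff of \<open>T\<close> is the expectation of \<open>exp (- q T) (g + \<delta>) (X\<^sub>T)\<close> minus \<open>\<delta> x\<close>. Since
  \<open>g + \<delta> \<le> D h\<close> and \<open>h\<close> is \<open>q\<close>-superharmonic, this is at most \<open>D h x - \<delta> x\<close>. As there are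
  no upward jumps, \<open>X\<close> sits at \<open>u\<close> when it first enters \<open>[u, \<infinity>)\<close>, so the hitting time of a level
  \<open>u \<ge> x\<close> yields \<open>(g u + \<delta> u) / h u * h x - \<delta> x\<close>.

  The strong Markov property is only needed for potentials of continuous functions, where it follows
  from the Markov property at fixed times by discretising \<open>T\<close> from the right.\<close>

text \<open>The main obstacle is \<open>h\<close>. It is known only through Laplace transforms of
  hitting times of single points, whereas the upper bound needs an inequality for \<open>h\<close>
  at arbitrary stopping times. The link is the potential of a running cost that vanishes up to a
  level \<open>b\<close> and is positive above it: below \<open>b\<close> this potential is a
  constant multiple of \<open>h\<close>, so the strong Markov property of potentials carries over to
  \<open>h\<close> until the entrance into [b, \<infinity>). After that entrance nothing is known
  about \<open>h\<close> along the path, hence the truncation at \<open>h b\<close> and the passage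
  of \<open>b\<close> towards the upper end of \<open>E\<close>. If that end belongs to
  \<open>E\<close>, the cost with \<open>b\<close> placed there would be zero on \<open>E\<close>;
  the levels then approach it from below and left continuity of \<open>h\<close> closes the gap. A
  second obstacle is that the hitting time of a closed half-line cannot be read off from the path at
  rational times. It is compared with an increasing limit of entrance times into open half-lines;
  the two differ only on a set that is null under all the laws, and the usual conditions absorb
  it.\<close>

section \<open>Approximation of times from the right and joint measurability\<close>

definition grid_above :: "nat \<Rightarrow> real \<Rightarrow> real" where
  "grid_above n s = (real_of_int \<lfloor>real (Suc n) * s\<rfloor> + 1) / real (Suc n)"

text \<open>Rounding is floor plus one and not ceiling, so the inequality is strict even at grid
  points. Strictness is what makes limits along the grid right limits.\<close>

lemma less_grid_above: "s < grid_above n s"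
proof -
  have "s * real (Suc n) < real_of_int \<lfloor>real (Suc n) * s\<rfloor> + 1"
    using floor_correct[of "real (Suc n) * s"] by (simp add: mult.commute)
  then show ?thesis
    unfolding grid_above_def by (subst pos_less_divide_eq) simp_all
qed

lemma grid_above_le: "grid_above n s \<le> s + 1 / real (Suc n)"
proof -
  have "real_of_int \<lfloor>real (Suc n) * s\<rfloor> + 1 \<le> real (Suc n) * s + 1"
    using floor_correct[of "real (Suc n) * s"] by simp
  then have "grid_above n s \<le> (real (Suc n) * s + 1) / real (Suc n)"
    unfolding grid_above_def by (intro divide_right_mono) simp_all
  then show ?thesis by (simp add: add_divide_distrib)
qed

lemma grid_above_nonneg: "0 \<le> s \<Longrightarrow> 0 \<le> grid_above n s"
  using less_grid_above[of s n] by linarith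

lemma filterlim_grid_above: "filterlim (\<lambda>n. grid_above n s) (at_right s) sequentially"
proof (rule tendsto_imp_filterlim_at_right)
  have "(\<lambda>n. s + 1 / real (Suc n)) \<longlonglongrightarrow> s + 0"
    by (intro tendsto_intros LIMSEQ_Suc[OF lim_1_over_n])
  then have "(\<lambda>n. s + 1 / real (Suc n)) \<longlonglongrightarrow> s" by simp
  then show "(\<lambda>n. grid_above n s) \<longlonglongrightarrow> s"
    by (rule tendsto_sandwich[OF _ _ tendsto_const[of s], rotated 2])
      (intro always_eventually allI less_imp_le[OF less_grid_above] grid_above_le)+
qed (intro always_eventually allI less_grid_above)

text \<open>Freezing the time at the next grid point leaves only countably many time values, each
  with a measurable section; right continuity recovers the function as a pointwise limit. This
  serves both the paths and the semigroup. The clamp \<open>max 0 s\<close> gives a function on the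
  whole line although \<open>G\<close> is controlled at nonnegative times only.\<close>

lemma borel_measurable_pair_right_continuous:
  fixes G :: "real \<Rightarrow> 'b \<Rightarrow> real"
  assumes meas: "\<And>t. 0 \<le> t \<Longrightarrow> G t \<in> borel_measurable N"
    and rc: "\<And>t b. 0 \<le> t \<Longrightarrow> b \<in> space N \<Longrightarrow> ((\<lambda>s. G s b) \<longlongrightarrow> G t b) (at_right t)"
  shows "(\<lambda>(s, b). G (max 0 s) b) \<in> borel_measurable (borel \<Otimes>\<^sub>M N)"
proof (rule borel_measurable_LIMSEQ_real)
  fix z :: "real \<times> 'b" assume "z \<in> space (borel \<Otimes>\<^sub>M N)"
  then obtain s b where z: "z = (s, b)" "b \<in> space N" by (auto simp: space_pair_measure)
  have "(\<lambda>n. G (grid_above n (max 0 s)) b) \<longlonglongrightarrow> G (max 0 s) b"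
    using rc[of "max 0 s" b] z by (intro filterlim_compose[OF _ filterlim_grid_above]) auto
  then show "(\<lambda>n. case z of (s, b) \<Rightarrow> G (grid_above n (max 0 s)) b) \<longlonglongrightarrow> (case z of (s, b) \<Rightarrow> G (max 0 s) b)"
    by (simp add: z)
next
  fix n
  have [measurable]: "(\<lambda>z. \<lfloor>real (Suc n) * max 0 (fst z)\<rfloor>) \<in> borel \<Otimes>\<^sub>M N \<rightarrow>\<^sub>M count_space UNIV"
    by measurable
  \<comment> \<open>The index \<open>k\<close> ranges over all integers here, so the inner
    \<open>max 0\<close> keeps every section within the reach of \<open>meas\<close>; on the indices
    that actually occur it changes nothing.\<close>
  have "(\<lambda>z. (\<lambda>k z. G (max 0 ((real_of_int k + 1) / real (Suc n))) (snd z))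
            \<lfloor>real (Suc n) * max 0 (fst z)\<rfloor> z) \<in> borel_measurable (borel \<Otimes>\<^sub>M N)"
    by (rule measurable_compose_countable) (auto intro!: measurable_compose[OF measurable_snd] meas)
  also have "(\<lambda>z. (\<lambda>k z. G (max 0 ((real_of_int k + 1) / real (Suc n))) (snd z))
            \<lfloor>real (Suc n) * max 0 (fst z)\<rfloor> z) = (\<lambda>(s, b). G (grid_above n (max 0 s)) b)"
  proof
    fix z :: "real \<times> 'b"
    show "(\<lambda>k z. G (max 0 ((real_of_int k + 1) / real (Suc n))) (snd z))
            \<lfloor>real (Suc n) * max 0 (fst z)\<rfloor> z = (\<lambda>(s, b). G (grid_above n (max 0 s)) b) z"
      using grid_above_nonneg[of "max 0 (fst z)" n]
      by (simp add: grid_above_def split: prod.split)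
  qed
  finally show "(\<lambda>(s, b). G (grid_above n (max 0 s)) b) \<in> borel_measurable (borel \<Otimes>\<^sub>M N)" .
qed

section \<open>The space \<open>C0\<close>\<close>

lemma C0_bounded:
  assumes "f \<in> C0 E"
  obtains B where "0 \<le> B" "\<And>y. y \<in> E \<Longrightarrow> \<bar>f y\<bar> \<le> B"
proof -
  have "\<forall>e>0. \<exists>K\<subseteq>E. compact K \<and> (\<forall>x\<in>E - K. \<bar>f x\<bar> < e)"
    using assms by (simp add: C0_def)
  from this[rule_format, of 1] obtain K
    where K: "K \<subseteq> E" "compact K" "\<And>y. y \<in> E - K \<Longrightarrow> \<bar>f y\<bar> < 1"
    by auto
  have "continuous_on K f"
    using assms K by (auto simp: C0_def intro: continuous_on_subset)
  then have "bounded (f ` K)"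
    using K by (intro compact_imp_bounded compact_continuous_image)
  then obtain B where B: "\<And>y. y \<in> K \<Longrightarrow> \<bar>f y\<bar> \<le> B" by (auto simp: bounded_iff)
  have "\<bar>f y\<bar> \<le> max 1 B" if "y \<in> E" for y
  proof (cases "y \<in> K")
    case True then show ?thesis using B by (simp add: le_max_iff_disj)
  next
    case False then show ?thesis using K(3)[of y] that by simp
  qed
  then show ?thesis by (intro that[of "max 1 B"]) auto
qed

lemma C0_continuous_on: "f \<in> C0 E \<Longrightarrow> continuous_on E f"
  by (simp add: C0_def)

lemma C0_I:
  assumes "continuous_on E f" "K \<subseteq> E" "compact K" "\<And>y. y \<in> E - K \<Longrightarrow> f y = 0"
  shows "f \<in> C0 E"
  using assms unfolding C0_def by (auto intro!: exI[of _ K])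

text \<open>A limit point lying between two points of an interval belongs to it, so only the two end
  points can be missing. Finiteness makes \<open>closure E - E\<close> closed, and thus the distance
  to it positive on \<open>E\<close> when it is nonempty.\<close>

lemma finite_closure_diff_interval:
  fixes E :: "real set"
  assumes E: "is_interval E"
  shows "finite (closure E - E)"
proof -
  have "closure E - E \<subseteq> {Inf E, Sup E}"
  proof
    fix b assume b: "b \<in> closure E - E"
    then have cl: "b \<in> closure E" "b \<notin> E" by auto
    then have "E \<noteq> {}" by auto
    then obtain e where e: "e \<in> E" by blast
    have between: "\<not> (y \<le> b \<and> b \<le> z)" if "y \<in> E" "z \<in> E" for y z
      using mem_is_interval_1_I[OF E, of y z b] that cl by auto
    have "b = Inf E" if "b < e"
    proof (rule sym, rule cInf_eq_non_empty)
      show "b \<le> y" if "y \<in> E" for y using between[OF that e] \<open>b < e\<close> by auto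
      show "y \<le> b" if "\<And>x. x \<in> E \<Longrightarrow> y \<le> x" for y
        using closure_minimal[of E "{y..}"] that cl by auto
    qed (use e in auto)
    moreover have "b = Sup E" if "e < b"
    proof (rule sym, rule cSup_eq_non_empty)
      show "y \<le> b" if "y \<in> E" for y using between[OF e that] \<open>e < b\<close> by auto
      show "b \<le> y" if "\<And>x. x \<in> E \<Longrightarrow> x \<le> y" for y
        using closure_minimal[of E "{..y}"] that cl by auto
    qed (use e in auto)
    ultimately show "b \<in> {Inf E, Sup E}" using e cl by (cases b e rule: linorder_cases) auto
  qed
  then show ?thesis by (rule finite_subset) simp
qed

lemma borel_interval:
  fixes E :: "real set"
  assumes E: "is_interval E"
  shows "E \<in> sets borel"
proof -
  have "E = closure E - (closure E - E)" using closure_subset by blast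
  also have "\<dots> \<in> sets borel"
    by (intro sets.Diff borel_closed closed_closure finite_imp_closed finite_closure_diff_interval E)
  finally show ?thesis .
qed

text \<open>The cutoffs vanish near \<open>closure E - E\<close> and outside a ball. The case distinction is needed
  because \<open>infdist\<close> to the empty set is \<open>0\<close>.\<close>

lemma interval_cutoffs:
  fixes E :: "real set"
  assumes E: "is_interval E"
  obtains \<phi> :: "nat \<Rightarrow> real \<Rightarrow> real"
  where "\<And>n y. 0 \<le> \<phi> n y" "\<And>n y. \<phi> n y \<le> 1" "\<And>y. mono (\<lambda>n. \<phi> n y)"
    "\<And>y. y \<in> E \<Longrightarrow> (\<lambda>n. \<phi> n y) \<longlonglongrightarrow> 1"
    "\<And>n f. continuous_on E f \<Longrightarrow> (\<lambda>y. \<phi> n y * f y) \<in> C0 E"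
proof -
  define B where "B = closure E - E"
  have B: "closed B"
    unfolding B_def by (intro finite_imp_closed finite_closure_diff_interval E)
  \<comment> \<open>For nonempty \<open>B\<close> this is 0 where
    \<open>real n * infdist y B\<close> is at most 1 and 1 where it is at least 2. These two
    thresholds reappear in the compact set \<open>K\<close> and in the choice of
    \<open>n2\<close>.\<close>
  define \<psi> where "\<psi> n y = (if B = {} then 1 else max 0 (min 1 (real n * infdist y B - 1)))" for n y
  define \<phi> where "\<phi> n y = \<psi> n y * max 0 (min 1 (real n - \<bar>y\<bar>))" for n y
  have [simp]: "0 \<le> \<psi> n y" "\<psi> n y \<le> 1" for n y by (auto simp: \<psi>_def)
  show ?thesis
  proof (rule that)
    show "0 \<le> \<phi> n y" for n y unfolding \<phi>_def by simp
    show "\<phi> n y \<le> 1" for n y unfolding \<phi>_def by (intro mult_le_one) auto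
    show "mono (\<lambda>n. \<phi> n y)" for y
    proof (rule monoI)
      fix m n :: nat assume "m \<le> n"
      then have "real m * infdist y B \<le> real n * infdist y B"
        by (intro mult_right_mono) (auto simp: infdist_nonneg)
      then have "\<psi> m y \<le> \<psi> n y" by (auto simp: \<psi>_def)
      with \<open>m \<le> n\<close> show "\<phi> m y \<le> \<phi> n y" unfolding \<phi>_def by (intro mult_mono) auto
    qed
    show "(\<lambda>n. \<phi> n y) \<longlonglongrightarrow> 1" if y: "y \<in> E" for y
    proof -
      obtain n1 :: nat where n1: "\<bar>y\<bar> + 1 \<le> real n1" using real_arch_simple by blast
      obtain n2 :: nat where n2: "B \<noteq> {} \<Longrightarrow> 2 \<le> real n2 * infdist y B"
      proof (cases "B = {}")
        case False
        then have "infdist y B > 0"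
          using B y in_closed_iff_infdist_zero[of B y] infdist_nonneg[of y B] by (auto simp: B_def less_le)
        then obtain n :: nat where "2 \<le> real n * infdist y B"
          using reals_Archimedean3 less_imp_le by blast
        then show ?thesis using that by blast
      qed (use that in auto)
      have "\<phi> n y = 1" if "max n1 n2 \<le> n" for n
      proof -
        have "real n2 * infdist y B \<le> real n * infdist y B"
          using that by (intro mult_right_mono) (auto simp: infdist_nonneg)
        then have "\<psi> n y = 1" using n2 by (cases "B = {}") (simp_all add: \<psi>_def)
        then show ?thesis using n1 that by (auto simp: \<phi>_def)
      qed
      then show ?thesis by (intro tendsto_eventually eventually_sequentiallyI)
    qed
    show "(\<lambda>y. \<phi> n y * f y) \<in> C0 E" if f: "continuous_on E f" for n f
    proof (rule C0_I)
      have "continuous_on E (\<psi> n)" unfolding \<psi>_def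
        by (cases "B = {}") (auto intro!: continuous_intros)
      then show "continuous_on E (\<lambda>y. \<phi> n y * f y)"
        using f unfolding \<phi>_def by (auto intro!: continuous_intros)
      \<comment> \<open>Taking the closure makes \<open>K\<close> closed; the distance condition
        removes the end points that the closure added, which puts \<open>K\<close> back inside
        \<open>E\<close>.\<close>
      define K where "K = closure E \<inter> cball 0 (real n) \<inter> {y. B \<noteq> {} \<longrightarrow> 1 \<le> real n * infdist y B}"
      have "closed {y. B \<noteq> {} \<longrightarrow> 1 \<le> real n * infdist y B}"
        by (cases "B = {}") (auto intro!: closed_Collect_le continuous_intros)
      then show "compact K" unfolding K_def
        by (intro compact_Int_closed closed_Int_compact closed_closure compact_cball)
      show "K \<subseteq> E"
      proof
        fix y assume y: "y \<in> K"
        then have "y \<notin> B" by (auto simp: K_def)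
        with y show "y \<in> E" by (auto simp: K_def B_def)
      qed
      show "\<phi> n y * f y = 0" if "y \<in> E - K" for y
      proof -
        have "y \<in> closure E" using that closure_subset by blast
        with that have "\<not> \<bar>y\<bar> \<le> real n \<or> (B \<noteq> {} \<and> \<not> 1 \<le> real n * infdist y B)"
          by (simp add: K_def) 
        then show ?thesis by (elim disjE) (simp_all add: \<phi>_def \<psi>_def)
      qed
    qed
  qed
qed

section \<open>The strong Markov property for potentials\<close>

text \<open>The strict inequality complements the weak one in \<open>cost\<close>, so the two add up
  with no boundary term. Discounting still runs from time 0, which is why a factor
  \<open>discount q (T \<omega>)\<close> appears in the Markov identities. Values in
  \<open>ennreal\<close> spare all integrability questions until the payoff is treated.\<close>

definition tail_cost ::
  "(real \<Rightarrow> 'a \<Rightarrow> real) \<Rightarrow> real \<Rightarrow> (real \<Rightarrow> real) \<Rightarrow> ennreal \<Rightarrow> 'a \<Rightarrow> ennreal" where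
  "tail_cost X q c t \<omega> =
     (\<integral>\<^sup>+s. ennreal (c (X s \<omega>) * exp (- q * s)) * indicator {s. 0 \<le> s \<and> t < ennreal s} s \<partial>lborel)"

lemma discount_nonneg [simp]: "0 \<le> discount q t"
  by (simp add: discount_def)

lemma discount_le_1: "0 < q \<Longrightarrow> discount q t \<le> 1"
  by (simp add: discount_def)

lemma discount_ennreal: "0 \<le> t \<Longrightarrow> discount q (ennreal t) = exp (- q * t)"
  by (simp add: discount_def)

lemma discount_top [simp]: "discount q \<top> = 0"
  by (simp add: discount_def)

lemma borel_measurable_discount [measurable]: "discount q \<in> borel_measurable borel"
  unfolding discount_def[abs_def] by measurable

context feller_process
begin

section \<open>Measurability of paths, stopped positions and costs\<close>

text \<open>The functions \<open>g\<close>, \<open>c\<close>, \<open>h\<close> are total but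
  constrained on \<open>E\<close> alone, so they can be expected to be measurable only on the
  restricted space; accordingly \<open>X\<close> is treated as a map into it.\<close>

abbreviation "borel_E \<equiv> restrict_space (borel :: real measure) E"

lemma space_P: "x \<in> E \<Longrightarrow> space (P x) = space M"
  by (rule sets_eq_imp_space_eq[OF sets_P])

lemma space_borel_E [simp]: "space borel_E = E"
  by (simp add: space_restrict_space)

lemma measurable_P_iff: "x \<in> E \<Longrightarrow> measurable (P x) N = measurable M N"
  by (intro measurable_cong_sets sets_P refl)

lemma measurable_FD: "f \<in> borel_measurable (F t) \<Longrightarrow> f \<in> borel_measurable M"
  using borel_measurable_subalgebra[OF sets_F] by (simp add: space_F)

lemma measurable_X: "0 \<le> t \<Longrightarrow> X t \<in> M \<rightarrow>\<^sub>M borel_E"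
  by (intro measurable_restrict_space2 measurable_FD[OF adapted]) (auto simp: range_X)

lemma measurable_X_pair: "(\<lambda>(s, \<omega>). X (max 0 s) \<omega>) \<in> borel \<Otimes>\<^sub>M M \<rightarrow>\<^sub>M borel_E"
proof (rule measurable_restrict_space2)
  show "(\<lambda>(s, \<omega>). X (max 0 s) \<omega>) \<in> borel_measurable (borel \<Otimes>\<^sub>M M)"
    by (rule borel_measurable_pair_right_continuous) (auto intro: measurable_FD adapted cadlag_right)
qed (auto simp: space_pair_measure range_X)

lemma measurable_X_compose:
  assumes "t \<in> borel_measurable N" "w \<in> N \<rightarrow>\<^sub>M M" "\<And>z. z \<in> space N \<Longrightarrow> 0 \<le> t z"
  shows "(\<lambda>z. X (t z) (w z)) \<in> N \<rightarrow>\<^sub>M borel_E"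
proof -
  have "(\<lambda>z. (\<lambda>(s, \<omega>). X (max 0 s) \<omega>) (t z, w z)) \<in> N \<rightarrow>\<^sub>M borel_E"
    by (rule measurable_compose[OF measurable_Pair measurable_X_pair]) (use assms in auto)
  moreover have "X (max 0 (t z)) (w z) = X (t z) (w z)" if "z \<in> space N" for z
    using assms(3)[OF that] by (simp add: max_def)
  ultimately show ?thesis by (simp cong: measurable_cong)
qed

lemma measurable_X_at [measurable]:
  assumes [measurable]: "T \<in> borel_measurable M"
  shows "(\<lambda>\<omega>. X (enn2real (T \<omega>)) \<omega>) \<in> M \<rightarrow>\<^sub>M borel_E"
  by (rule measurable_X_compose) auto

text \<open>Both claims are measurability of a partial integral of a jointly measurable function.
  Replacing \<open>s\<close> by \<open>max 0 s\<close> makes the integrand jointly measurable, and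
  the indicator hides the change.\<close>

lemma measurable_path_cost:
  fixes T :: "'a \<Rightarrow> ennreal"
  assumes [measurable]: "c \<in> borel_measurable borel_E" "T \<in> borel_measurable M"
  shows "(\<lambda>\<omega>. cost X q c (T \<omega>) \<omega>) \<in> borel_measurable M"
    and "(\<lambda>\<omega>. tail_cost X q c (T \<omega>) \<omega>) \<in> borel_measurable M"
proof -
  have [measurable]: "(\<lambda>z. X (max 0 (snd z)) (fst z)) \<in> M \<Otimes>\<^sub>M lborel \<rightarrow>\<^sub>M borel_E"
    by (rule measurable_X_compose) auto
  have 1: "(\<lambda>\<omega>. \<integral>\<^sup>+s. ennreal (c (X (max 0 s) \<omega>) * exp (- q * s)) *
      indicator {z. 0 \<le> snd z \<and> ennreal (snd z) \<le> T (fst z)} (\<omega>, s) \<partial>lborel) \<in> borel_measurable M"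
    by measurable
  have 2: "(\<lambda>\<omega>. \<integral>\<^sup>+s. ennreal (c (X (max 0 s) \<omega>) * exp (- q * s)) *
      indicator {z. 0 \<le> snd z \<and> T (fst z) < ennreal (snd z)} (\<omega>, s) \<partial>lborel) \<in> borel_measurable M"
    by measurable
  from 1 show "(\<lambda>\<omega>. cost X q c (T \<omega>) \<omega>) \<in> borel_measurable M"
    unfolding cost_def
    by (rule measurable_cong[THEN iffD2, rotated])
      (intro nn_integral_cong, auto split: split_indicator simp: max_def)
  from 2 show "(\<lambda>\<omega>. tail_cost X q c (T \<omega>) \<omega>) \<in> borel_measurable M"
    unfolding tail_cost_def
    by (rule measurable_cong[THEN iffD2, rotated])
      (intro nn_integral_cong, auto split: split_indicator simp: max_def)
qed

lemma measurable_path: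
  assumes "\<omega> \<in> space M"
  shows "(\<lambda>s. X (max 0 s) \<omega>) \<in> borel \<rightarrow>\<^sub>M borel_E"
  by (rule measurable_X_compose) (use assms in auto)

lemma cost_add_tail_cost:
  assumes [measurable]: "c \<in> borel_measurable borel_E" and \<omega>: "\<omega> \<in> space M"
  shows "cost X q c t \<omega> + tail_cost X q c t \<omega> = cost X q c \<infinity> \<omega>"
proof -
  note [measurable] = measurable_path[OF \<omega>]
  let ?f = "\<lambda>s. ennreal (c (X (max 0 s) \<omega>) * exp (- q * s))"
  have "cost X q c t \<omega> + tail_cost X q c t \<omega> =
      (\<integral>\<^sup>+s. ?f s * indicator {s. 0 \<le> s \<and> ennreal s \<le> t} s \<partial>lborel) +
      (\<integral>\<^sup>+s. ?f s * indicator {s. 0 \<le> s \<and> t < ennreal s} s \<partial>lborel)"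
    unfolding cost_def tail_cost_def
    by (intro arg_cong2[where f = "(+)"] nn_integral_cong) (auto split: split_indicator simp: max_def)
  also have "\<dots> = (\<integral>\<^sup>+s. ?f s * indicator {s. 0 \<le> s \<and> ennreal s \<le> t} s +
      ?f s * indicator {s. 0 \<le> s \<and> t < ennreal s} s \<partial>lborel)"
    by (rule nn_integral_add[symmetric]) measurable
  also have "\<dots> = cost X q c \<infinity> \<omega>"
    unfolding cost_def by (intro nn_integral_cong) (auto split: split_indicator simp: max_def)
  finally show ?thesis .
qed

lemma cost_top_eq: "cost X q c \<infinity> \<omega> =
    (\<integral>\<^sup>+s. ennreal (c (X (max 0 s) \<omega>) * exp (- q * s)) * indicator {0<..} s \<partial>lborel)"
proof -
  have "AE s in lborel. s \<noteq> (0::real)" by (rule AE_lborel_singleton)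
  then show ?thesis unfolding cost_def
    by (intro nn_integral_cong_AE) (auto split: split_indicator simp: max_def elim: eventually_mono)
qed

section \<open>The semigroup and its resolvent on \<open>C0\<close>\<close>

definition transition :: "real \<Rightarrow> (real \<Rightarrow> real) \<Rightarrow> real \<Rightarrow> real" where
  "transition s f y = (\<integral>\<omega>. f (X s \<omega>) \<partial>P y)"

lemma transition_C0: "f \<in> C0 E \<Longrightarrow> 0 \<le> t \<Longrightarrow> transition t f \<in> C0 E"
  unfolding transition_def[abs_def] by (rule feller)

lemma C0_measurable: "f \<in> C0 E \<Longrightarrow> f \<in> borel_measurable borel_E"
  by (intro borel_measurable_continuous_on_restrict C0_continuous_on)

lemma transition_nonneg: "(\<And>y. y \<in> E \<Longrightarrow> 0 \<le> f y) \<Longrightarrow> 0 \<le> s \<Longrightarrow> y \<in> E \<Longrightarrow> 0 \<le> transition s f y"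
  unfolding transition_def by (intro Bochner_Integration.integral_nonneg) (simp add: range_X space_P)

lemma integrable_C0_compose:
  assumes f: "f \<in> C0 E" and Y: "Y \<in> M \<rightarrow>\<^sub>M borel_E" and y: "y \<in> E"
  shows "integrable (P y) (\<lambda>\<omega>. f (Y \<omega>))"
proof -
  interpret prob_space "P y" by (rule prob_P[OF y])
  obtain B where B: "\<And>y. y \<in> E \<Longrightarrow> \<bar>f y\<bar> \<le> B" using C0_bounded[OF f] by blast
  have "(\<lambda>\<omega>. f (Y \<omega>)) \<in> borel_measurable (P y)"
    using measurable_compose[OF Y C0_measurable[OF f]] by (simp add: measurable_P_iff y)
  then show ?thesis
    using measurable_space[OF Y] B by (intro integrable_const_bound[of _ B] AE_I2) (auto simp: space_P y)
qed

lemma ennreal_transition: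
  assumes "f \<in> C0 E" "\<And>y. y \<in> E \<Longrightarrow> 0 \<le> f y" "0 \<le> s" "y \<in> E"
  shows "ennreal (transition s f y) = (\<integral>\<^sup>+\<omega>. ennreal (f (X s \<omega>)) \<partial>P y)"
  unfolding transition_def
  by (intro nn_integral_eq_integral[symmetric] integrable_C0_compose measurable_X AE_I2)
    (use assms in \<open>auto simp: range_X space_P\<close>)

text \<open>Right continuity of the paths and bounded convergence. It is wanted for the joint
  measurability of the semigroup in time and space.\<close>

lemma transition_right_continuous:
  assumes f: "f \<in> C0 E" and t: "0 \<le> t" and y: "y \<in> E"
  shows "((\<lambda>s. transition s f y) \<longlongrightarrow> transition t f y) (at_right t)"
  unfolding tendsto_at_iff_sequentially comp_def
proof (intro allI impI)
  fix s :: "nat \<Rightarrow> real" assume s: "\<forall>i. s i \<in> {t<..} - {t}" "s \<longlonglongrightarrow> t"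
  interpret prob_space "P y" by (rule prob_P[OF y])
  obtain B where B: "\<And>y. y \<in> E \<Longrightarrow> \<bar>f y\<bar> \<le> B" using C0_bounded[OF f] by blast
  have s0: "0 \<le> s i" for i using s(1) t by (auto intro: order_trans less_imp_le)
  have m: "(\<lambda>\<omega>. f (X r \<omega>)) \<in> borel_measurable (P y)" if "0 \<le> r" for r
    using measurable_compose[OF measurable_X[OF that] C0_measurable[OF f]] by (simp add: measurable_P_iff y)
  show "(\<lambda>i. transition (s i) f y) \<longlonglongrightarrow> transition t f y"
    unfolding transition_def
  proof (rule integral_dominated_convergence[where w = "\<lambda>_. B"])
    have "filterlim s (at_right t) sequentially"
      using s by (intro tendsto_imp_filterlim_at_right) auto
    then have "(\<lambda>i. X (s i) \<omega>) \<longlonglongrightarrow> X t \<omega>" if "\<omega> \<in> space M" for \<omega>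
      using cadlag_right[OF t that] by (rule filterlim_compose[rotated])
    then show "AE \<omega> in P y. (\<lambda>i. f (X (s i) \<omega>)) \<longlonglongrightarrow> f (X t \<omega>)"
      by (intro AE_I2 continuous_on_tendsto_compose[OF C0_continuous_on[OF f]])
        (auto simp: space_P y range_X t s0)
  qed (auto simp: m t s0 space_P y range_X B)
qed

lemma measurable_transition_pair:
  assumes f: "f \<in> C0 E"
  shows "(\<lambda>(s, y). transition (max 0 s) f y) \<in> borel_measurable (borel \<Otimes>\<^sub>M borel_E)"
  by (rule borel_measurable_pair_right_continuous)
    (auto intro: C0_measurable transition_C0 transition_right_continuous f)

text \<open>The conditional expectation is tested against an event of the past. The nonnegative form
  can be integrated over \<open>s\<close> by Tonelli without further conditions.\<close>

lemma markov_nn: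
  assumes f: "f \<in> C0 E" and f0: "\<And>y. y \<in> E \<Longrightarrow> 0 \<le> f y"
    and A: "A \<in> sets (F (ennreal t))" and t: "0 \<le> t" and s: "0 \<le> s" and x: "x \<in> E"
  shows "(\<integral>\<^sup>+\<omega>. indicator A \<omega> * ennreal (f (X (t + s) \<omega>)) \<partial>P x) =
    (\<integral>\<^sup>+\<omega>. indicator A \<omega> * ennreal (transition s f (X t \<omega>)) \<partial>P x)"
proof -
  interpret prob_space "P x" by (rule prob_P[OF x])
  interpret finite_measure_subalgebra "P x" "F (ennreal t)"
    by unfold_locales (simp add: subalgebra_def space_P sets_P x sets_F space_F)
  have AM: "A \<in> sets (P x)" using A sets_F sets_P[OF x] by blast
  have i1: "integrable (P x) (\<lambda>\<omega>. f (X (t + s) \<omega>))"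
    by (intro integrable_C0_compose f x measurable_X) (use s t in auto)
  have i2: "integrable (P x) (\<lambda>\<omega>. transition s f (X t \<omega>))"
    by (intro integrable_C0_compose transition_C0 f x measurable_X s t)
  note i12 = integrable_mult_indicator[OF AM i1] integrable_mult_indicator[OF AM i2]
  have "(LINT \<omega>:A|P x. f (X (t + s) \<omega>)) =
      (LINT \<omega>:A|P x. real_cond_exp (P x) (F (ennreal t)) (\<lambda>\<omega>'. f (X (t + s) \<omega>')) \<omega>)"
    by (rule real_cond_exp_intA[OF i1 A])
  also have "\<dots> = (LINT \<omega>:A|P x. transition s f (X t \<omega>))"
    unfolding set_lebesgue_integral_def
  proof (rule integral_cong_AE)
    show "AE \<omega> in P x. indicat_real A \<omega> *\<^sub>R real_cond_exp (P x) (F (ennreal t)) (\<lambda>\<omega>'. f (X (t + s) \<omega>')) \<omega> =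
        indicat_real A \<omega> *\<^sub>R transition s f (X t \<omega>)"
      using markov[OF f s t x] by eventually_elim (simp add: transition_def)
    show "(\<lambda>\<omega>. indicat_real A \<omega> *\<^sub>R transition s f (X t \<omega>)) \<in> borel_measurable (P x)"
      using i12(2) by (rule borel_measurable_integrable)
    show "(\<lambda>\<omega>. indicat_real A \<omega> *\<^sub>R real_cond_exp (P x) (F (ennreal t)) (\<lambda>\<omega>'. f (X (t + s) \<omega>')) \<omega>)
        \<in> borel_measurable (P x)"
      using AM by measurable
  qed
  finally have eq: "(\<integral>\<omega>. indicat_real A \<omega> *\<^sub>R f (X (t + s) \<omega>) \<partial>P x) =
      (\<integral>\<omega>. indicat_real A \<omega> *\<^sub>R transition s f (X t \<omega>) \<partial>P x)"
    unfolding set_lebesgue_integral_def .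
  have "(\<integral>\<^sup>+\<omega>. indicator A \<omega> * ennreal (f (X (t + s) \<omega>)) \<partial>P x) =
      (\<integral>\<^sup>+\<omega>. ennreal (indicat_real A \<omega> *\<^sub>R f (X (t + s) \<omega>)) \<partial>P x)"
    by (intro nn_integral_cong) (simp split: split_indicator)
  also have "\<dots> = ennreal (\<integral>\<omega>. indicat_real A \<omega> *\<^sub>R f (X (t + s) \<omega>) \<partial>P x)"
    by (intro nn_integral_eq_integral i12 AE_I2) (use s t x in \<open>simp add: space_P f0 range_X\<close>)
  also have "\<dots> = (\<integral>\<^sup>+\<omega>. ennreal (indicat_real A \<omega> *\<^sub>R transition s f (X t \<omega>)) \<partial>P x)"
    unfolding eq
    by (intro nn_integral_eq_integral[symmetric] i12 AE_I2)
      (use s t x in \<open>simp add: space_P f0 range_X transition_nonneg\<close>)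
  also have "\<dots> = (\<integral>\<^sup>+\<omega>. indicator A \<omega> * ennreal (transition s f (X t \<omega>)) \<partial>P x)"
    by (intro nn_integral_cong) (simp split: split_indicator)
  finally show ?thesis .
qed

lemma measurable_P_borel: "f \<in> borel_measurable M \<Longrightarrow> y \<in> E \<Longrightarrow> f \<in> borel_measurable (P y)"
  by (simp add: measurable_P_iff)

lemma pair_P_lborel: "y \<in> E \<Longrightarrow> pair_sigma_finite lborel (P y)"
  by (intro pair_sigma_finite.intro lborel.sigma_finite_measure_axioms
      finite_measure.axioms(1) prob_space.axioms(1) prob_P)

lemma nn_integral_time_swap:
  fixes G :: "real \<Rightarrow> 'a \<Rightarrow> ennreal"
  assumes "y \<in> E" "(\<lambda>(s, \<omega>). G s \<omega>) \<in> borel_measurable (borel \<Otimes>\<^sub>M M)"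
  shows "(\<integral>\<^sup>+\<omega>. (\<integral>\<^sup>+s. G s \<omega> \<partial>lborel) \<partial>P y) = (\<integral>\<^sup>+s. (\<integral>\<^sup>+\<omega>. G s \<omega> \<partial>P y) \<partial>lborel)"
proof (rule pair_sigma_finite.Fubini'[OF pair_P_lborel[OF assms(1)]])
  have "sets (lborel \<Otimes>\<^sub>M P y) = sets (borel \<Otimes>\<^sub>M M)"
    by (intro sets_pair_measure_cong sets_P assms) simp
  then show "(\<lambda>(s, \<omega>). G s \<omega>) \<in> borel_measurable (lborel \<Otimes>\<^sub>M P y)"
    using assms(2) measurable_cong_sets by blast
qed

lemma measurable_cost_pair:
  assumes [measurable]: "c \<in> borel_measurable borel_E"
  shows "(\<lambda>(s, \<omega>). ennreal (c (X (max 0 s) \<omega>) * exp (- q * s)) * indicator {0<..} s)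
    \<in> borel_measurable (borel \<Otimes>\<^sub>M M)"
proof -
  have [measurable]: "(\<lambda>z. X (max 0 (fst z)) (snd z)) \<in> borel \<Otimes>\<^sub>M M \<rightarrow>\<^sub>M borel_E"
    by (rule measurable_X_compose) auto
  show ?thesis unfolding split_beta' by measurable
qed

lemma measurable_transition_time:
  assumes f: "f \<in> C0 E" and y: "y \<in> E"
  shows "(\<lambda>s. transition (max 0 s) f y) \<in> borel_measurable borel"
  using measurable_compose[OF measurable_Pair2'[of y] measurable_transition_pair[OF f]] y by simp

text \<open>By Tonelli the potential is the Laplace transform of the semigroup, that is, the
  \<open>q\<close>-resolvent applied to \<open>f\<close>. Continuity and the Markov property of the
  potential are read off from this form.\<close>

lemma total_cost_C0:
  assumes f: "f \<in> C0 E" and f0: "\<And>y. y \<in> E \<Longrightarrow> 0 \<le> f y" and y: "y \<in> E"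
  shows "total_cost P X q f y =
    (\<integral>\<^sup>+s. ennreal (exp (- q * s) * transition (max 0 s) f y) * indicator {0<..} s \<partial>lborel)"
proof -
  note [measurable] = C0_measurable[OF f] 
  have "total_cost P X q f y = (\<integral>\<^sup>+\<omega>. (\<integral>\<^sup>+s. ennreal (f (X (max 0 s) \<omega>) * exp (- q * s)) *
      indicator {0<..} s \<partial>lborel) \<partial>P y)"
    unfolding total_cost_def cost_top_eq ..
  also have "\<dots> = (\<integral>\<^sup>+s. (\<integral>\<^sup>+\<omega>. ennreal (f (X (max 0 s) \<omega>) * exp (- q * s)) *
      indicator {0<..} s \<partial>P y) \<partial>lborel)"
    by (intro nn_integral_time_swap y measurable_cost_pair C0_measurable f)
  also have "\<dots> = (\<integral>\<^sup>+s. ennreal (exp (- q * s) * transition (max 0 s) f y) * indicator {0<..} s \<partial>lborel)"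
  proof (intro nn_integral_cong)
    fix s :: real
    have [measurable]: "(\<lambda>\<omega>. f (X (max 0 s) \<omega>)) \<in> borel_measurable (P y)"
      by (intro measurable_P_borel measurable_compose[OF measurable_X] C0_measurable f y) simp
    have "(\<integral>\<^sup>+\<omega>. ennreal (f (X (max 0 s) \<omega>) * exp (- q * s)) * indicator {0<..} s \<partial>P y) =
        (\<integral>\<^sup>+\<omega>. ennreal (f (X (max 0 s) \<omega>)) * (ennreal (exp (- q * s)) * indicator {0<..} s) \<partial>P y)"
      by (intro nn_integral_cong) (simp add: ennreal_mult f0 range_X space_P y mult.assoc)
    also have "\<dots> = (\<integral>\<^sup>+\<omega>. ennreal (f (X (max 0 s) \<omega>)) \<partial>P y) * (ennreal (exp (- q * s)) * indicator {0<..} s)"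
      by (intro nn_integral_multc) measurable
    also have "\<dots> = ennreal (exp (- q * s) * transition (max 0 s) f y) * indicator {0<..} s"
      by (subst ennreal_transition[symmetric]) (simp_all add: f f0 y ennreal_mult transition_nonneg mult_ac)
    finally show "(\<integral>\<^sup>+\<omega>. ennreal (f (X (max 0 s) \<omega>) * exp (- q * s)) * indicator {0<..} s \<partial>P y) =
        ennreal (exp (- q * s) * transition (max 0 s) f y) * indicator {0<..} s" .
  qed
  finally show ?thesis .
qed

lemma nn_integral_exp_indicator:
  fixes q B t :: real
  assumes q: "0 < q" and B: "0 \<le> B"
  shows "(\<integral>\<^sup>+s. ennreal (B * exp (- q * s)) * indicator {0<..} s \<partial>lborel) = ennreal (B / q)"
proof -
  have lim: "((\<lambda>s. - (B / q) * exp (- q * s)) \<longlongrightarrow> - (B / q) * 0) at_top"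
    by (intro tendsto_mult tendsto_const filterlim_compose[OF exp_at_bot]
        filterlim_tendsto_neg_mult_at_bot[of _ "- q"] filterlim_ident) (use q in auto)
  have "(\<integral>\<^sup>+s. ennreal (B * exp (- q * s)) * indicator {0..} s \<partial>lborel) = ennreal (0 - (- (B / q) * exp (- q * 0)))"
    by (rule nn_integral_FTC_atLeast[where F = "\<lambda>s. - (B / q) * exp (- q * s)"])
      (use q B lim in \<open>auto intro!: derivative_eq_intros simp: field_simps\<close>)
  also have "(\<integral>\<^sup>+s. ennreal (B * exp (- q * s)) * indicator {0..} s \<partial>lborel) =
      (\<integral>\<^sup>+s. ennreal (B * exp (- q * s)) * indicator {0<..} s \<partial>lborel)"
    using AE_lborel_singleton[of "0::real"]
    by (intro nn_integral_cong_AE) (auto split: split_indicator elim: eventually_mono)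
  finally show ?thesis by simp
qed

lemma transition_bounded:
  assumes "f \<in> C0 E" "\<And>y. y \<in> E \<Longrightarrow> \<bar>f y\<bar> \<le> B" "0 \<le> s" "y \<in> E"
  shows "\<bar>transition s f y\<bar> \<le> B"
proof -
  interpret prob_space "P y" by (rule prob_P) fact
  have "\<bar>transition s f y\<bar> \<le> (\<integral>\<omega>. \<bar>f (X s \<omega>)\<bar> \<partial>P y)"
    unfolding transition_def by (rule integral_abs_bound)
  also have "\<dots> \<le> B"
    by (intro integral_le_const integrable_abs integrable_C0_compose measurable_X AE_I2)
      (use assms in \<open>auto simp: range_X space_P\<close>)
  finally show ?thesis .
qed

lemma total_cost_le:
  assumes q: "0 < q" and f[measurable]: "f \<in> borel_measurable borel_E"
    and f0: "\<And>y. y \<in> E \<Longrightarrow> 0 \<le> f y" "\<And>y. y \<in> E \<Longrightarrow> f y \<le> B" and y: "y \<in> E"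
  shows "total_cost P X q f y \<le> ennreal (B / q)"
proof -
  interpret prob_space "P y" by (rule prob_P[OF y])
  have B: "0 \<le> B" using f0[OF y] by linarith
  have "cost X q f \<infinity> \<omega> \<le> ennreal (B / q)" if "\<omega> \<in> space M" for \<omega>
    unfolding cost_top_eq nn_integral_exp_indicator[OF q B, symmetric]
    by (intro nn_integral_mono mult_right_mono ennreal_leI) (auto simp: f0 range_X that)
  then have "total_cost P X q f y \<le> (\<integral>\<^sup>+\<omega>. ennreal (B / q) \<partial>P y)"
    unfolding total_cost_def by (intro nn_integral_mono) (simp add: space_P y)
  then show ?thesis by (simp add: emeasure_space_1)
qed

text \<open>This is where the Feller property enters: \<open>transition s f\<close> is continuous on
  \<open>E\<close> for each \<open>s\<close>, and the bound \<open>B * exp (- q * s)\<close> allows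
  dominated convergence. Continuity of the resolvent is what lets the discretised strong Markov
  identity pass to the limit.\<close>

lemma total_cost_C0_tendsto:
  assumes q: "0 < q" and f: "f \<in> C0 E" and f0: "\<And>y. y \<in> E \<Longrightarrow> 0 \<le> f y"
    and y: "\<And>n. y n \<in> E" "z \<in> E" "y \<longlonglongrightarrow> z"
  shows "(\<lambda>n. total_cost P X q f (y n)) \<longlonglongrightarrow> total_cost P X q f z"
proof -
  obtain B where B: "0 \<le> B" "\<And>y. y \<in> E \<Longrightarrow> \<bar>f y\<bar> \<le> B" using C0_bounded[OF f] by blast
  note [measurable] = measurable_transition_time[OF f y(1)] measurable_transition_time[OF f y(2)]
  have "(\<lambda>n. \<integral>\<^sup>+s. ennreal (exp (- q * s) * transition (max 0 s) f (y n)) * indicator {0<..} s \<partial>lborel)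
      \<longlonglongrightarrow> (\<integral>\<^sup>+s. ennreal (exp (- q * s) * transition (max 0 s) f z) * indicator {0<..} s \<partial>lborel)"
  proof (rule nn_integral_dominated_convergence[where
        w = "\<lambda>s. ennreal (B * exp (- q * s)) * indicator {0<..} s"])
    show "AE s in lborel. ennreal (exp (- q * s) * transition (max 0 s) f (y n)) * indicator {0<..} s
        \<le> ennreal (B * exp (- q * s)) * indicator {0<..} s" for n
    proof (intro AE_I2 mult_right_mono ennreal_leI)
      fix s :: real
      have "transition (max 0 s) f (y n) \<le> B"
        using transition_bounded[OF f B(2), of "max 0 s" "y n"] y(1) by simp
      then show "exp (- q * s) * transition (max 0 s) f (y n) \<le> B * exp (- q * s)"
        by (subst mult.commute) (intro mult_right_mono, simp_all)
    qed simp
    show "AE s in lborel. (\<lambda>n. ennreal (exp (- q * s) * transition (max 0 s) f (y n)) * indicator {0<..} s)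
        \<longlonglongrightarrow> ennreal (exp (- q * s) * transition (max 0 s) f z) * indicator {0<..} s"
    proof (intro AE_I2)
      fix s :: real
      have "(\<lambda>n. transition (max 0 s) f (y n)) \<longlonglongrightarrow> transition (max 0 s) f z"
        by (rule continuous_on_tendsto_compose[OF C0_continuous_on[OF transition_C0[OF f]] y(3,2)])
          (simp_all add: y)
      then show "(\<lambda>n. ennreal (exp (- q * s) * transition (max 0 s) f (y n)) * indicator {0<..} s)
        \<longlonglongrightarrow> ennreal (exp (- q * s) * transition (max 0 s) f z) * indicator {0<..} s"
        by (cases "0 < s") (auto intro!: tendsto_intros)
    qed
  next
    show "(\<integral>\<^sup>+s. ennreal (B * exp (- q * s)) * indicator {0<..} s \<partial>lborel) < \<infinity>"
      unfolding nn_integral_exp_indicator[OF q B(1)] by simp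
  qed measurable
  moreover have "total_cost P X q f v =
      (\<integral>\<^sup>+s. ennreal (exp (- q * s) * transition (max 0 s) f v) * indicator {0<..} s \<partial>lborel)" if "v \<in> E" for v
    by (rule total_cost_C0[OF f f0 that])
  ultimately show ?thesis by (simp only: y)
qed

text \<open>Shifting the time variable by \<open>t\<close> turns both sides into integrals over
  \<open>s > 0\<close> with the same weight \<open>?w s\<close>. After exchanging the integrals it
  remains to apply the Markov property at time \<open>t\<close> for each \<open>s\<close>
  separately.\<close>

lemma tail_cost_markov:
  assumes f: "f \<in> C0 E" and f0: "\<And>y. y \<in> E \<Longrightarrow> 0 \<le> f y"
    and A: "A \<in> sets (F (ennreal t))" and t: "0 \<le> t" and x: "x \<in> E"
  shows "(\<integral>\<^sup>+\<omega>. indicator A \<omega> * tail_cost X q f (ennreal t) \<omega> \<partial>P x) =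
    (\<integral>\<^sup>+\<omega>. indicator A \<omega> * (ennreal (exp (- q * t)) * total_cost P X q f (X t \<omega>)) \<partial>P x)"
proof -
  note [measurable] = C0_measurable[OF f]
  have AM[measurable]: "A \<in> sets M" using A sets_F by blast
  have mX[measurable]: "(\<lambda>z. X (max 0 (t + fst z)) (snd z)) \<in> borel \<Otimes>\<^sub>M M \<rightarrow>\<^sub>M borel_E"
    by (rule measurable_X_compose) auto
  have [measurable]: "X t \<in> M \<rightarrow>\<^sub>M borel_E" by (rule measurable_X[OF t])
  have mT[measurable]: "(\<lambda>z. transition (max 0 (fst z)) f (X t (snd z))) \<in> borel_measurable (borel \<Otimes>\<^sub>M M)"
  proof -
    have "(\<lambda>z. (\<lambda>(s, y). transition (max 0 s) f y) (fst z, X t (snd z))) \<in> borel_measurable (borel \<Otimes>\<^sub>M M)"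
      by (rule measurable_compose[OF _ measurable_transition_pair[OF f]]) measurable
    then show ?thesis by simp
  qed
  let ?w = "\<lambda>s. ennreal (exp (- q * (t + s))) * indicator {0<..} s"
  have tail: "tail_cost X q f (ennreal t) \<omega> =
      (\<integral>\<^sup>+s. ennreal (f (X (max 0 (t + s)) \<omega>)) * ?w s \<partial>lborel)" if \<omega>: "\<omega> \<in> space M" for \<omega>
  proof -
    note [measurable] = measurable_path[OF \<omega>]
    have "tail_cost X q f (ennreal t) \<omega> =
      (\<integral>\<^sup>+s. ennreal (f (X (max 0 s) \<omega>) * exp (- q * s)) * indicator {t<..} s \<partial>lborel)"
      unfolding tail_cost_def using t
      by (intro nn_integral_cong) (auto split: split_indicator simp: max_def ennreal_less_iff)
    also have "\<dots> = (\<integral>\<^sup>+s. ennreal (f (X (max 0 (t + s)) \<omega>) * exp (- q * (t + s))) * indicator {t<..} (t + s) \<partial>lborel)"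
      \<comment> \<open>Translation invariance of Lebesgue measure: the affine substitution has
        slope 1 and offset \<open>t\<close>.\<close>
      by (subst nn_integral_real_affine[where c = 1 and t = t]) simp_all
    also have "\<dots> = (\<integral>\<^sup>+s. ennreal (f (X (max 0 (t + s)) \<omega>)) * ?w s \<partial>lborel)"
      by (intro nn_integral_cong) (simp add: ennreal_mult f0 range_X \<omega> split: split_indicator)
    finally show ?thesis .
  qed
  have pot: "ennreal (exp (- q * t)) * total_cost P X q f (X t \<omega>) =
      (\<integral>\<^sup>+s. ennreal (transition (max 0 s) f (X t \<omega>)) * ?w s \<partial>lborel)" if \<omega>: "\<omega> \<in> space M" for \<omega>
  proof -
    have y: "X t \<omega> \<in> E" using range_X t \<omega> by blast
    note [measurable] = measurable_transition_time[OF f y]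
    have U: "total_cost P X q f (X t \<omega>) =
      (\<integral>\<^sup>+s. ennreal (exp (- q * s) * transition (max 0 s) f (X t \<omega>)) * indicator {0<..} s \<partial>lborel)"
      by (rule total_cost_C0[OF f f0 y])
    have "ennreal (exp (- q * t)) * total_cost P X q f (X t \<omega>) =
      (\<integral>\<^sup>+s. ennreal (exp (- q * t)) * (ennreal (exp (- q * s) * transition (max 0 s) f (X t \<omega>)) * indicator {0<..} s) \<partial>lborel)"
      unfolding U by (rule nn_integral_cmult[symmetric]) measurable
    also have "\<dots> = (\<integral>\<^sup>+s. ennreal (transition (max 0 s) f (X t \<omega>)) * ?w s \<partial>lborel)"
    proof (rule nn_integral_cong)
      fix s :: real
      have "0 \<le> transition (max 0 s) f (X t \<omega>)" by (intro transition_nonneg f0 y) simp_all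
      moreover have "exp (- q * (t + s)) = exp (- q * t) * exp (- q * s)"
        unfolding exp_add[symmetric] by (simp add: algebra_simps)
      ultimately show "ennreal (exp (- q * t)) * (ennreal (exp (- q * s) * transition (max 0 s) f (X t \<omega>)) *
          indicator {0<..} s) = ennreal (transition (max 0 s) f (X t \<omega>)) * ?w s"
        by (simp add: ennreal_mult mult_ac)
    qed
    finally show ?thesis .
  qed
  have "(\<integral>\<^sup>+\<omega>. indicator A \<omega> * tail_cost X q f (ennreal t) \<omega> \<partial>P x) =
      (\<integral>\<^sup>+\<omega>. (\<integral>\<^sup>+s. indicator A \<omega> * (ennreal (f (X (max 0 (t + s)) \<omega>)) * ?w s) \<partial>lborel) \<partial>P x)"
  proof (rule nn_integral_cong)
    fix \<omega> assume "\<omega> \<in> space (P x)"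
    then have \<omega>: "\<omega> \<in> space M" by (simp add: space_P x)
    have [measurable]: "(\<lambda>s. X (max 0 (t + s)) \<omega>) \<in> borel \<rightarrow>\<^sub>M borel_E"
      by (rule measurable_X_compose) (use \<omega> in auto)
    show "indicator A \<omega> * tail_cost X q f (ennreal t) \<omega> =
       (\<integral>\<^sup>+s. indicator A \<omega> * (ennreal (f (X (max 0 (t + s)) \<omega>)) * ?w s) \<partial>lborel)"
      unfolding tail[OF \<omega>] by (rule nn_integral_cmult[symmetric]) measurable
  qed
  also have "\<dots> = (\<integral>\<^sup>+s. (\<integral>\<^sup>+\<omega>. indicator A \<omega> * (ennreal (f (X (max 0 (t + s)) \<omega>)) * ?w s) \<partial>P x) \<partial>lborel)"
    by (intro nn_integral_time_swap x) (unfold split_beta', measurable)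
  also have "\<dots> = (\<integral>\<^sup>+s. (\<integral>\<^sup>+\<omega>. indicator A \<omega> * (ennreal (transition (max 0 s) f (X t \<omega>)) * ?w s) \<partial>P x) \<partial>lborel)"
  proof (rule nn_integral_cong)
    fix s :: real
    show "(\<integral>\<^sup>+\<omega>. indicator A \<omega> * (ennreal (f (X (max 0 (t + s)) \<omega>)) * ?w s) \<partial>P x) =
      (\<integral>\<^sup>+\<omega>. indicator A \<omega> * (ennreal (transition (max 0 s) f (X t \<omega>)) * ?w s) \<partial>P x)"
    proof (cases "0 < s")
      case True
      have [measurable]: "A \<in> sets (P x)" using AM by (simp add: sets_P x)
      have [measurable]: "(\<lambda>\<omega>. f (X (t + s) \<omega>)) \<in> borel_measurable (P x)"
        "(\<lambda>\<omega>. transition s f (X t \<omega>)) \<in> borel_measurable (P x)"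
        using True t by (auto intro!: measurable_P_borel measurable_compose[OF measurable_X] C0_measurable f x transition_C0)
      have m: "max 0 (t + s) = t + s" "max 0 s = s" using True t by auto
      have "(\<integral>\<^sup>+\<omega>. indicator A \<omega> * ennreal (f (X (t + s) \<omega>)) * ?w s \<partial>P x) =
          (\<integral>\<^sup>+\<omega>. indicator A \<omega> * ennreal (f (X (t + s) \<omega>)) \<partial>P x) * ?w s"
        by (rule nn_integral_multc) measurable
      also have "\<dots> = (\<integral>\<^sup>+\<omega>. indicator A \<omega> * ennreal (transition s f (X t \<omega>)) \<partial>P x) * ?w s"
        using True by (intro arg_cong[where f = "\<lambda>v. v * ?w s"] markov_nn f f0 A t x) auto
      also have "\<dots> = (\<integral>\<^sup>+\<omega>. indicator A \<omega> * ennreal (transition s f (X t \<omega>)) * ?w s \<partial>P x)"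
        by (rule nn_integral_multc[symmetric]) measurable
      finally show ?thesis unfolding m mult.assoc .
    next
      case False
      then have w: "?w s = 0" by simp
      show ?thesis unfolding w by simp
    qed
  qed
  also have "\<dots> = (\<integral>\<^sup>+\<omega>. (\<integral>\<^sup>+s. indicator A \<omega> * (ennreal (transition (max 0 s) f (X t \<omega>)) * ?w s) \<partial>lborel) \<partial>P x)"
    by (intro nn_integral_time_swap[symmetric] x) (unfold split_beta', measurable)
  also have "\<dots> = (\<integral>\<^sup>+\<omega>. indicator A \<omega> * (ennreal (exp (- q * t)) * total_cost P X q f (X t \<omega>)) \<partial>P x)"
  proof (rule nn_integral_cong)
    fix \<omega> assume "\<omega> \<in> space (P x)"
    then have \<omega>: "\<omega> \<in> space M" by (simp add: space_P x)
    have [measurable]: "(\<lambda>s. transition (max 0 s) f (X t \<omega>)) \<in> borel_measurable borel"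
      by (intro measurable_transition_time f range_X t \<omega>)
    show "(\<integral>\<^sup>+s. indicator A \<omega> * (ennreal (transition (max 0 s) f (X t \<omega>)) * ?w s) \<partial>lborel) =
       indicator A \<omega> * (ennreal (exp (- q * t)) * total_cost P X q f (X t \<omega>))"
      unfolding pot[OF \<omega>] by (rule nn_integral_cmult) measurable
  qed
  finally show ?thesis .
qed

lemma measurable_T: "stopping_time F T \<Longrightarrow> T \<in> borel_measurable M"
  using measurable_stopping_time[of F T M] sets_F space_F by simp

lemma cost_top_eq_tail: "cost X q c \<infinity> \<omega> = tail_cost X q c 0 \<omega>"
  unfolding cost_top_eq tail_cost_def
  by (intro nn_integral_cong) (auto split: split_indicator simp: max_def)

lemma tail_cost_top [simp]: "tail_cost X q c \<top> \<omega> = 0"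
  unfolding tail_cost_def by simp

lemma tail_cost_le_bound:
  assumes q: "0 < q" and f0: "\<And>y. y \<in> E \<Longrightarrow> f y \<le> B" and B: "0 \<le> B" and \<omega>: "\<omega> \<in> space M"
  shows "tail_cost X q f t \<omega> \<le> ennreal (B / q)"
proof -
  have "tail_cost X q f t \<omega> \<le> (\<integral>\<^sup>+s. ennreal (B * exp (- q * s)) * indicator {0<..} s \<partial>lborel)"
    unfolding tail_cost_def
    by (intro nn_integral_mono)
      (auto split: split_indicator intro!: ennreal_leI mult_right_mono f0 range_X \<omega> simp: less_le)
  then show ?thesis by (simp only: nn_integral_exp_indicator[OF q B])
qed

lemma total_cost_measurable_C0:
  assumes f: "f \<in> C0 E" and f0: "\<And>y. y \<in> E \<Longrightarrow> 0 \<le> f y"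
  shows "total_cost P X q f \<in> borel_measurable borel_E"
proof -
  have [measurable]: "(\<lambda>z. transition (max 0 (snd z)) f (fst z)) \<in> borel_measurable (borel_E \<Otimes>\<^sub>M lborel)"
  proof -
    have "(\<lambda>z. (\<lambda>(s, y). transition (max 0 s) f y) (snd z, fst z)) \<in> borel_measurable (borel_E \<Otimes>\<^sub>M lborel)"
      by (rule measurable_compose[OF _ measurable_transition_pair[OF f]]) measurable
    then show ?thesis by simp
  qed
  have "(\<lambda>y. \<integral>\<^sup>+s. ennreal (exp (- q * s) * transition (max 0 s) f y) * indicator {0<..} s \<partial>lborel)
      \<in> borel_measurable borel_E"
    by measurable
  then show ?thesis
    by (rule measurable_cong[THEN iffD2, rotated]) (simp only: space_borel_E total_cost_C0[OF f f0])
qed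

section \<open>Discretisation of stopping times\<close>

text \<open>The cells are disjoint and cover the finite times, so the series has at most one nonzero
  term. It writes a functional of the rounded time as a sum over deterministic times, with value 0
  at infinity.\<close>

lemma grid_stopping_sum:
  fixes H :: "real \<Rightarrow> ennreal" and T :: "'a \<Rightarrow> ennreal"
  shows "(\<Sum>j. H ((real j + 1) / real (Suc n)) *
      indicator {\<omega> \<in> space M. T \<omega> < \<infinity> \<and> \<lfloor>real (Suc n) * enn2real (T \<omega>)\<rfloor> = int j} \<omega>) =
    (if T \<omega> < \<infinity> \<and> \<omega> \<in> space M then H (grid_above n (enn2real (T \<omega>))) else 0)"
proof (cases "T \<omega> < \<infinity> \<and> \<omega> \<in> space M")
  case True
  define k where "k = nat \<lfloor>real (Suc n) * enn2real (T \<omega>)\<rfloor>"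
  have k: "\<lfloor>real (Suc n) * enn2real (T \<omega>)\<rfloor> = int k" unfolding k_def by simp
  have "H ((real k + 1) / real (Suc n)) = H (grid_above n (enn2real (T \<omega>)))"
    unfolding grid_above_def k by simp
  moreover have "(\<Sum>j. H ((real j + 1) / real (Suc n)) *
      indicator {\<omega> \<in> space M. T \<omega> < \<infinity> \<and> \<lfloor>real (Suc n) * enn2real (T \<omega>)\<rfloor> = int j} \<omega>) =
      H ((real k + 1) / real (Suc n))"
    by (rule suminf_cmult_indicator) (use k True in \<open>auto simp: disjoint_family_on_def\<close>)
  ultimately show ?thesis using True by simp
next
  case False
  then have ind: "indicator {\<omega> \<in> space M. T \<omega> < \<infinity> \<and> \<lfloor>real (Suc n) * enn2real (T \<omega>)\<rfloor> = int j} \<omega> = (0::ennreal)" for j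
    by (auto split: split_indicator)
  show ?thesis unfolding ind if_not_P[OF False] by simp
qed

text \<open>The cell is half-open, \<open>j / (n + 1)\<close> included and
  \<open>(j + 1) / (n + 1)\<close> excluded, and the rounded time on it is the right end. Hence the
  event is already decided at that time, which is what the fixed-time Markov property
  requires.\<close>

lemma grid_stopping_set:
  assumes T: "stopping_time F T"
  shows "{\<omega> \<in> space M. T \<omega> < \<infinity> \<and> \<lfloor>real (Suc n) * enn2real (T \<omega>)\<rfloor> = int j}
    \<in> sets (F (ennreal ((real j + 1) / real (Suc n))))" (is "?A \<in> sets (F ?t)")
proof -
  have le: "ennreal (real j / real (Suc n)) \<le> ?t"
    by (intro ennreal_leI divide_right_mono) auto
  have "{\<omega> \<in> space M. T \<omega> < ennreal (real j / real (Suc n))} \<in> sets (F (ennreal (real j / real (Suc n))))"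
    using stopping_time_less_const[OF T] by (simp add: pred_def space_F)
  then have 1: "{\<omega> \<in> space M. T \<omega> < ennreal (real j / real (Suc n))} \<in> sets (F ?t)"
    using sets_F_mono[OF le] by blast
  have 2: "{\<omega> \<in> space M. T \<omega> < ?t} \<in> sets (F ?t)"
    using stopping_time_less_const[OF T] by (simp add: pred_def space_F)
  have "?A = {\<omega> \<in> space M. T \<omega> < ?t} - {\<omega> \<in> space M. T \<omega> < ennreal (real j / real (Suc n))}"
  proof -
    have "(T \<omega> < \<infinity> \<and> \<lfloor>real (Suc n) * enn2real (T \<omega>)\<rfloor> = int j) \<longleftrightarrow>
        (T \<omega> < ?t \<and> \<not> T \<omega> < ennreal (real j / real (Suc n)))" for \<omega>
    proof (cases "T \<omega>")
      case (real r)
      have "\<lfloor>real (Suc n) * r\<rfloor> = int j \<longleftrightarrow> real j \<le> r * real (Suc n) \<and> r * real (Suc n) < real j + 1"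
        by (auto simp: floor_eq_iff mult.commute)
      also have "\<dots> \<longleftrightarrow> real j / real (Suc n) \<le> r \<and> r < (real j + 1) / real (Suc n)"
        by (simp only: pos_divide_le_eq pos_less_divide_eq of_nat_0_less_iff zero_less_Suc)
      finally show ?thesis using real by (auto simp: ennreal_less_iff not_less simp del: of_nat_Suc)
    next
      case top
      then show ?thesis by (simp add: less_top[symmetric])
    qed
    then show ?thesis by blast
  qed
  then show ?thesis using 1 2 by (simp only: sets.Diff)
qed

lemma strong_markov_grid:
  fixes T :: "'a \<Rightarrow> ennreal"
  assumes f: "f \<in> C0 E" and f0: "\<And>y. y \<in> E \<Longrightarrow> 0 \<le> f y"
    and T: "stopping_time F T" and x: "x \<in> E"
  defines "Tn \<equiv> \<lambda>n \<omega>. if T \<omega> < \<infinity> then ennreal (grid_above n (enn2real (T \<omega>))) else \<infinity>"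
  shows "(\<integral>\<^sup>+\<omega>. tail_cost X q f (Tn n \<omega>) \<omega> \<partial>P x) =
    (\<integral>\<^sup>+\<omega>. ennreal (discount q (Tn n \<omega>)) * total_cost P X q f (X (enn2real (Tn n \<omega>)) \<omega>) \<partial>P x)"
proof -
  let ?t = "\<lambda>j. (real j + 1) / real (Suc n)"
  define A where "A j = {\<omega> \<in> space M. T \<omega> < \<infinity> \<and> \<lfloor>real (Suc n) * enn2real (T \<omega>)\<rfloor> = int j}" for j
  have A: "A j \<in> sets (F (ennreal (?t j)))" for j unfolding A_def by (rule grid_stopping_set[OF T])
  then have AM: "A j \<in> sets M" for j using sets_F by blast
  have AP [measurable]: "A j \<in> sets (P x)" for j using AM by (simp add: sets_P x)
  have t0: "0 \<le> ?t j" for j by simp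
  have m1 [measurable]: "tail_cost X q f (ennreal (?t j)) \<in> borel_measurable (P x)" for j
    using measurable_path_cost(2)[OF C0_measurable[OF f], of "\<lambda>_. ennreal (?t j)"]
    by (intro measurable_P_borel x) simp
  have m2 [measurable]: "(\<lambda>\<omega>. total_cost P X q f (X (?t j) \<omega>)) \<in> borel_measurable (P x)" for j
    by (intro measurable_P_borel x measurable_compose[OF measurable_X total_cost_measurable_C0] f f0 t0)
  have "(\<integral>\<^sup>+\<omega>. tail_cost X q f (Tn n \<omega>) \<omega> \<partial>P x) =
      (\<integral>\<^sup>+\<omega>. (\<Sum>j. tail_cost X q f (ennreal (?t j)) \<omega> * indicator (A j) \<omega>) \<partial>P x)"
    unfolding A_def grid_stopping_sum[where H = "\<lambda>t. tail_cost X q f (ennreal t) _"] Tn_def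
    by (intro nn_integral_cong) (simp add: space_P x)
  also have "\<dots> = (\<Sum>j. (\<integral>\<^sup>+\<omega>. tail_cost X q f (ennreal (?t j)) \<omega> * indicator (A j) \<omega> \<partial>P x))"
    by (rule nn_integral_suminf) measurable
  also have "\<dots> = (\<Sum>j. (\<integral>\<^sup>+\<omega>. ennreal (exp (- q * ?t j)) * total_cost P X q f (X (?t j) \<omega>) *
      indicator (A j) \<omega> \<partial>P x))"
    using tail_cost_markov[OF f f0 A t0 x] by (simp only: mult.commute[of _ "indicator _ _"])
  also have "\<dots> = (\<integral>\<^sup>+\<omega>. (\<Sum>j. ennreal (exp (- q * ?t j)) * total_cost P X q f (X (?t j) \<omega>) *
      indicator (A j) \<omega>) \<partial>P x)"
    by (rule nn_integral_suminf[symmetric]) measurable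
  also have "\<dots> = (\<integral>\<^sup>+\<omega>. ennreal (discount q (Tn n \<omega>)) *
      total_cost P X q f (X (enn2real (Tn n \<omega>)) \<omega>) \<partial>P x)"
  proof (rule nn_integral_cong)
    fix \<omega> assume "\<omega> \<in> space (P x)"
    then have \<omega>: "\<omega> \<in> space M" by (simp add: space_P x)
    have g: "0 \<le> grid_above n (enn2real (T \<omega>))" by (intro grid_above_nonneg) simp
    show "(\<Sum>j. ennreal (exp (- q * ?t j)) * total_cost P X q f (X (?t j) \<omega>) * indicator (A j) \<omega>) =
        ennreal (discount q (Tn n \<omega>)) * total_cost P X q f (X (enn2real (Tn n \<omega>)) \<omega>)"
      unfolding A_def grid_stopping_sum[where H = "\<lambda>t. ennreal (exp (- q * t)) * total_cost P X q f (X t \<omega>)"]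
      using \<omega> by (cases "T \<omega> < \<infinity>") (simp_all add: Tn_def discount_ennreal g)
  qed
  finally show ?thesis .
qed

text \<open>The rounded times tend to \<open>T\<close> strictly from the right. Tail costs converge
  along each path; potentials converge because the path is right-continuous and the potential is
  continuous. The common bound \<open>B / q\<close> gives dominated convergence on both
  sides.\<close>

lemma strong_markov_C0:
  assumes q: "0 < q" and f: "f \<in> C0 E" and f0: "\<And>y. y \<in> E \<Longrightarrow> 0 \<le> f y"
    and T: "stopping_time F T" and x: "x \<in> E"
  shows "(\<integral>\<^sup>+\<omega>. tail_cost X q f (T \<omega>) \<omega> \<partial>P x) =
    (\<integral>\<^sup>+\<omega>. ennreal (discount q (T \<omega>)) * total_cost P X q f (X (enn2real (T \<omega>)) \<omega>) \<partial>P x)"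
proof -
  interpret prob_space "P x" by (rule prob_P[OF x])
  define Tn where "Tn n \<omega> = (if T \<omega> < \<infinity> then ennreal (grid_above n (enn2real (T \<omega>))) else \<infinity>)" for n \<omega>
  obtain B where B: "0 \<le> B" "\<And>y. y \<in> E \<Longrightarrow> \<bar>f y\<bar> \<le> B" using C0_bounded[OF f] by blast
  then have B': "f y \<le> B" if "y \<in> E" for y using that by (meson abs_le_D1)
  have [measurable]: "T \<in> borel_measurable M" by (rule measurable_T[OF T])
  have [measurable]: "Tn n \<in> borel_measurable M" for n unfolding Tn_def grid_above_def by measurable
  note [measurable] = C0_measurable[OF f] total_cost_measurable_C0[OF f f0]
  have fin: "(\<integral>\<^sup>+\<omega>. ennreal (B / q) \<partial>P x) < \<infinity>" by (simp add: emeasure_space_1)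
  have mtail: "(\<lambda>\<omega>. tail_cost X q f (S \<omega>) \<omega>) \<in> borel_measurable (P x)"
    if [measurable]: "S \<in> borel_measurable M" for S
    by (intro measurable_P_borel x measurable_path_cost) measurable
  have mpot: "(\<lambda>\<omega>. ennreal (discount q (S \<omega>)) * total_cost P X q f (X (enn2real (S \<omega>)) \<omega>)) \<in> borel_measurable (P x)"
    if [measurable]: "S \<in> borel_measurable M" for S
    by (intro measurable_P_borel x) measurable
  have lim_tail: "(\<lambda>n. tail_cost X q f (Tn n \<omega>) \<omega>) \<longlonglongrightarrow> tail_cost X q f (T \<omega>) \<omega>"
    if \<omega>: "\<omega> \<in> space M" for \<omega>
  proof (cases "T \<omega> < \<infinity>")
    case True
    define t where "t = enn2real (T \<omega>)"
    have t: "0 \<le> t" "T \<omega> = ennreal t" using True by (auto simp: t_def)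
    have Tn: "Tn n \<omega> = ennreal (grid_above n t)" for n using True by (simp add: Tn_def t_def)
    have g0: "0 \<le> grid_above n t" for n using t by (intro grid_above_nonneg)
    note [measurable] = measurable_path[OF \<omega>]
    let ?f = "\<lambda>s. ennreal (f (X (max 0 s) \<omega>) * exp (- q * s))"
    have eq: "tail_cost X q f (ennreal r) \<omega> = (\<integral>\<^sup>+s. ?f s * indicator {r<..} s \<partial>lborel)" if "0 \<le> r" for r
      unfolding tail_cost_def using that
      by (intro nn_integral_cong) (auto split: split_indicator simp: max_def ennreal_less_iff)
    have "(\<lambda>n. \<integral>\<^sup>+s. ?f s * indicator {grid_above n t<..} s \<partial>lborel) \<longlonglongrightarrow>
        (\<integral>\<^sup>+s. ?f s * indicator {t<..} s \<partial>lborel)"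
    proof (rule nn_integral_dominated_convergence[where
          w = "\<lambda>s. ennreal (B * exp (- q * s)) * indicator {0<..} s"])
      show "AE s in lborel. ?f s * indicator {grid_above n t<..} s \<le>
          ennreal (B * exp (- q * s)) * indicator {0<..} s" for n
        using g0[of n] by (intro AE_I2)
          (auto split: split_indicator intro!: ennreal_leI mult_right_mono B' range_X \<omega>)
      show "AE s in lborel. (\<lambda>n. ?f s * indicator {grid_above n t<..} s) \<longlonglongrightarrow> ?f s * indicator {t<..} s"
      proof (intro AE_I2)
        fix s :: real
        \<comment> \<open>The integrands agree for large \<open>n\<close> at every \<open>s\<close>,
          including \<open>s = t\<close>, where both indicators vanish because the rounded times
          stay strictly above \<open>t\<close>.\<close>
        have "eventually (\<lambda>n. ?f s * indicator {grid_above n t<..} s = ?f s * indicator {t<..} s) sequentially"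
        proof (cases "t < s")
          case True
          have "((\<lambda>n. grid_above n t) \<longlonglongrightarrow> t)"
            using filterlim_grid_above[of t] by (simp add: filterlim_at)
          then have "eventually (\<lambda>n. grid_above n t < s) sequentially"
            using True by (rule order_tendstoD)
          then show ?thesis by eventually_elim (simp add: True)
        next
          case False
          then have "\<not> grid_above n t < s" for n using less_grid_above[of t n] by linarith
          then show ?thesis using False by simp
        qed
        then show "(\<lambda>n. ?f s * indicator {grid_above n t<..} s) \<longlonglongrightarrow> ?f s * indicator {t<..} s"
          by (rule tendsto_eventually)
      qed
      show "(\<integral>\<^sup>+s. ennreal (B * exp (- q * s)) * indicator {0<..} s \<partial>lborel) < \<infinity>"
        unfolding nn_integral_exp_indicator[OF q B(1)] by simp
    qed measurable
    then show ?thesis unfolding Tn t(2) by (simp only: eq g0 t(1))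
  next
    case False
    then have "T \<omega> = \<infinity>" by (simp add: less_top[symmetric])
    then show ?thesis by (simp add: Tn_def)
  qed
  have lim_pot: "(\<lambda>n. ennreal (discount q (Tn n \<omega>)) * total_cost P X q f (X (enn2real (Tn n \<omega>)) \<omega>)) \<longlonglongrightarrow>
      ennreal (discount q (T \<omega>)) * total_cost P X q f (X (enn2real (T \<omega>)) \<omega>)" if \<omega>: "\<omega> \<in> space M" for \<omega>
  proof (cases "T \<omega> < \<infinity>")
    case True
    define t where "t = enn2real (T \<omega>)"
    have t: "0 \<le> t" "T \<omega> = ennreal t" using True by (auto simp: t_def)
    have Tn: "Tn n \<omega> = ennreal (grid_above n t)" for n using True by (simp add: Tn_def t_def)
    have g0: "0 \<le> grid_above n t" for n using t by (intro grid_above_nonneg)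
    have "(\<lambda>n. total_cost P X q f (X (grid_above n t) \<omega>)) \<longlonglongrightarrow> total_cost P X q f (X t \<omega>)"
      by (rule total_cost_C0_tendsto[OF q f f0])
        (auto intro!: range_X g0 t \<omega> filterlim_compose[OF cadlag_right filterlim_grid_above])
    moreover have "(\<lambda>n. ennreal (exp (- q * grid_above n t))) \<longlonglongrightarrow> ennreal (exp (- q * t))"
      using filterlim_grid_above[of t] by (intro tendsto_intros) (simp add: filterlim_at)
    moreover have "total_cost P X q f (X t \<omega>) \<noteq> \<top>"
    proof -
      have "total_cost P X q f (X t \<omega>) \<le> ennreal (B / q)"
        by (intro total_cost_le q C0_measurable f f0 B' range_X t(1) \<omega>)
      then show ?thesis by (auto simp: top_unique)
    qed
    ultimately have "(\<lambda>n. ennreal (exp (- q * grid_above n t)) * total_cost P X q f (X (grid_above n t) \<omega>))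
        \<longlonglongrightarrow> ennreal (exp (- q * t)) * total_cost P X q f (X t \<omega>)"
      by (intro tendsto_mult_ennreal) auto
    then show ?thesis unfolding Tn t(2) by (simp add: discount_ennreal g0 t(1))
  next
    case False
    then have "T \<omega> = \<infinity>" by (simp add: less_top[symmetric])
    then show ?thesis by (simp add: Tn_def)
  qed
  have "(\<lambda>n. \<integral>\<^sup>+\<omega>. tail_cost X q f (Tn n \<omega>) \<omega> \<partial>P x) \<longlonglongrightarrow> (\<integral>\<^sup>+\<omega>. tail_cost X q f (T \<omega>) \<omega> \<partial>P x)"
  proof (rule nn_integral_dominated_convergence[where w = "\<lambda>_. ennreal (B / q)"])
    show "(\<integral>\<^sup>+\<omega>. ennreal (B / q) \<partial>P x) < \<infinity>" by (rule fin)
  qed (auto intro!: mtail AE_I2 tail_cost_le_bound q B' B(1) lim_tail simp: space_P x)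
  moreover have "(\<lambda>n. \<integral>\<^sup>+\<omega>. ennreal (discount q (Tn n \<omega>)) * total_cost P X q f (X (enn2real (Tn n \<omega>)) \<omega>) \<partial>P x)
     \<longlonglongrightarrow> (\<integral>\<^sup>+\<omega>. ennreal (discount q (T \<omega>)) * total_cost P X q f (X (enn2real (T \<omega>)) \<omega>) \<partial>P x)"
  proof (rule nn_integral_dominated_convergence[where w = "\<lambda>_. ennreal (B / q)"])
    show "AE \<omega> in P x. ennreal (discount q (Tn n \<omega>)) * total_cost P X q f (X (enn2real (Tn n \<omega>)) \<omega>)
        \<le> ennreal (B / q)" for n
    proof (rule AE_I2)
      fix \<omega> assume "\<omega> \<in> space (P x)"
      then have \<omega>: "\<omega> \<in> space M" by (simp add: space_P x)
      have "ennreal (discount q (Tn n \<omega>)) * total_cost P X q f (X (enn2real (Tn n \<omega>)) \<omega>) \<le> 1 * ennreal (B / q)"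
        by (intro mult_mono total_cost_le q C0_measurable f f0 B' range_X \<omega>)
          (auto simp: discount_le_1 q)
      then show "ennreal (discount q (Tn n \<omega>)) * total_cost P X q f (X (enn2real (Tn n \<omega>)) \<omega>) \<le> ennreal (B / q)"
        by simp
    qed
    show "(\<integral>\<^sup>+\<omega>. ennreal (B / q) \<partial>P x) < \<infinity>" by (rule fin)
  qed (auto intro!: mpot AE_I2 lim_pot simp: space_P x)
  moreover have "(\<integral>\<^sup>+\<omega>. tail_cost X q f (Tn n \<omega>) \<omega> \<partial>P x) =
    (\<integral>\<^sup>+\<omega>. ennreal (discount q (Tn n \<omega>)) * total_cost P X q f (X (enn2real (Tn n \<omega>)) \<omega>) \<partial>P x)" for n
    unfolding Tn_def by (rule strong_markov_grid[OF f f0 T x])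
  ultimately show ?thesis using LIMSEQ_unique by auto
qed

section \<open>Passage from \<open>C0\<close> to nonnegative continuous costs\<close>

lemma C0_approximation:
  assumes c: "continuous_on E c" and c0: "\<And>y. y \<in> E \<Longrightarrow> 0 \<le> c y"
  obtains f :: "nat \<Rightarrow> real \<Rightarrow> real"
  where "\<And>n. f n \<in> C0 E" "\<And>n y. y \<in> E \<Longrightarrow> 0 \<le> f n y"
    "\<And>y. y \<in> E \<Longrightarrow> incseq (\<lambda>n. f n y)" "\<And>y. y \<in> E \<Longrightarrow> (\<lambda>n. f n y) \<longlonglongrightarrow> c y"
proof -
  obtain \<phi> :: "nat \<Rightarrow> real \<Rightarrow> real"
    where \<phi>: "\<And>n y. 0 \<le> \<phi> n y" "\<And>n y. \<phi> n y \<le> 1" "\<And>y. mono (\<lambda>n. \<phi> n y)"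
      "\<And>y. y \<in> E \<Longrightarrow> (\<lambda>n. \<phi> n y) \<longlonglongrightarrow> 1"
      "\<And>n f. continuous_on E f \<Longrightarrow> (\<lambda>y. \<phi> n y * f y) \<in> C0 E"
    using interval_cutoffs[OF interval(1)] by blast
  show ?thesis
  proof (rule that[of "\<lambda>n y. \<phi> n y * c y"])
    show "incseq (\<lambda>n. \<phi> n y * c y)" if "y \<in> E" for y
      using \<phi>(3)[of y] c0[OF that] by (auto simp: incseq_def mono_def intro: mult_right_mono)
    show "(\<lambda>n. \<phi> n y * c y) \<longlonglongrightarrow> c y" if "y \<in> E" for y
      using tendsto_mult[OF \<phi>(4)[OF that] tendsto_const[of "c y"]] by simp
  qed (use \<phi> c c0 in auto)
qed

lemma tail_cost_SUP:
  assumes f: "\<And>n. f n \<in> borel_measurable borel_E" "\<And>n y. y \<in> E \<Longrightarrow> 0 \<le> f n y"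
    and inc: "\<And>y. y \<in> E \<Longrightarrow> incseq (\<lambda>n. f n y)" and lim: "\<And>y. y \<in> E \<Longrightarrow> (\<lambda>n. f n y) \<longlonglongrightarrow> c y"
    and \<omega>: "\<omega> \<in> space M"
  shows "incseq (\<lambda>n. tail_cost X q (f n) t \<omega>)"
    and "tail_cost X q c t \<omega> = (SUP n. tail_cost X q (f n) t \<omega>)"
proof -
  note [measurable] = measurable_path[OF \<omega>] f(1)
  define A where "A = {s. 0 \<le> s \<and> t < ennreal s}"
  have [measurable]: "A \<in> sets borel" unfolding A_def by measurable
  let ?g = "\<lambda>c s. ennreal (c (X (max 0 s) \<omega>) * exp (- q * s)) * indicator A s"
  have eq: "tail_cost X q c t \<omega> = (\<integral>\<^sup>+s. ?g c s \<partial>lborel)" for c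
    unfolding tail_cost_def A_def by (intro nn_integral_cong) (auto split: split_indicator simp: max_def)
  have E: "X (max 0 s) \<omega> \<in> E" for s by (intro range_X \<omega>) simp
  have mono: "?g (f m) s \<le> ?g (f n) s" if "m \<le> n" for m n s
    using inc[OF E] that by (intro mult_right_mono ennreal_leI) (auto simp: incseq_def)
  then have incg: "incseq (\<lambda>n. ?g (f n))" by (auto simp: incseq_def le_fun_def)
  have sup: "?g c s = (SUP n. ?g (f n) s)" for s
  proof (rule LIMSEQ_unique)
    show "(\<lambda>n. ?g (f n) s) \<longlonglongrightarrow> (SUP n. ?g (f n) s)"
      using incg by (intro LIMSEQ_SUP) (auto simp: incseq_def le_fun_def)
    show "(\<lambda>n. ?g (f n) s) \<longlonglongrightarrow> ?g c s"
      using lim[OF E, of s] by (cases "s \<in> A") (auto intro!: tendsto_intros)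
  qed
  show "incseq (\<lambda>n. tail_cost X q (f n) t \<omega>)"
    unfolding eq using mono by (auto simp: incseq_def intro!: nn_integral_mono)
  show "tail_cost X q c t \<omega> = (SUP n. tail_cost X q (f n) t \<omega>)"
    unfolding eq sup by (rule nn_integral_monotone_convergence_SUP[OF incg]) measurable
qed

text \<open>Monotone convergence, stated for the tail after an arbitrary measurable time. With the
  time 0 it covers \<open>total_cost\<close> as well, by \<open>cost_top_eq_tail\<close>.\<close>

lemma total_cost_SUP:
  assumes f: "\<And>n. f n \<in> borel_measurable borel_E" "\<And>n y. y \<in> E \<Longrightarrow> 0 \<le> f n y"
    and inc: "\<And>y. y \<in> E \<Longrightarrow> incseq (\<lambda>n. f n y)" and lim: "\<And>y. y \<in> E \<Longrightarrow> (\<lambda>n. f n y) \<longlonglongrightarrow> c y"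
    and y: "y \<in> E" and T: "T \<in> borel_measurable M"
  shows "(\<integral>\<^sup>+\<omega>. tail_cost X q c (T \<omega>) \<omega> \<partial>P y) = (SUP n. \<integral>\<^sup>+\<omega>. tail_cost X q (f n) (T \<omega>) \<omega> \<partial>P y)"
    and "incseq (\<lambda>n. \<integral>\<^sup>+\<omega>. tail_cost X q (f n) (T \<omega>) \<omega> \<partial>P y)"
proof -
  have 1: "tail_cost X q c t \<omega> = (SUP n. tail_cost X q (f n) t \<omega>)"
    and 2: "incseq (\<lambda>n. tail_cost X q (f n) t \<omega>)" if "\<omega> \<in> space M" for t \<omega>
    using that by (auto intro!: tail_cost_SUP f inc lim)
  have "(\<integral>\<^sup>+\<omega>. tail_cost X q c (T \<omega>) \<omega> \<partial>P y) = (\<integral>\<^sup>+\<omega>. (SUP n. tail_cost X q (f n) (T \<omega>) \<omega>) \<partial>P y)"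
    by (intro nn_integral_cong 1) (auto simp: space_P y)
  also have "\<dots> = (SUP n. \<integral>\<^sup>+\<omega>. tail_cost X q (f n) (T \<omega>) \<omega> \<partial>P y)"
  proof (rule nn_integral_monotone_convergence_SUP_AE)
    show "AE \<omega> in P y. tail_cost X q (f n) (T \<omega>) \<omega> \<le> tail_cost X q (f (Suc n)) (T \<omega>) \<omega>" for n
      using 2 by (intro AE_I2) (simp add: space_P y incseq_Suc_iff)
  qed (intro measurable_P_borel measurable_path_cost f T y)
  finally show "(\<integral>\<^sup>+\<omega>. tail_cost X q c (T \<omega>) \<omega> \<partial>P y) = (SUP n. \<integral>\<^sup>+\<omega>. tail_cost X q (f n) (T \<omega>) \<omega> \<partial>P y)" .
  show "incseq (\<lambda>n. \<integral>\<^sup>+\<omega>. tail_cost X q (f n) (T \<omega>) \<omega> \<partial>P y)"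
    using 2 by (auto simp: incseq_def space_P y intro!: nn_integral_mono)
qed

text \<open>A continuous \<open>c\<close> may be unbounded, and its potential may then be infinite
  or fail to be continuous. Increasing limits of \<open>C0\<close> costs avoid both difficulties:
  measurability of the potential and the identity at \<open>T\<close> pass to suprema.\<close>

lemma
  assumes q: "0 < q" and c: "continuous_on E c" and c0: "\<And>y. y \<in> E \<Longrightarrow> 0 \<le> c y"
  shows total_cost_measurable: "total_cost P X q c \<in> borel_measurable borel_E"
    and strong_markov: "stopping_time F T \<Longrightarrow> x \<in> E \<Longrightarrow> (\<integral>\<^sup>+\<omega>. tail_cost X q c (T \<omega>) \<omega> \<partial>P x) =
      (\<integral>\<^sup>+\<omega>. ennreal (discount q (T \<omega>)) * total_cost P X q c (X (enn2real (T \<omega>)) \<omega>) \<partial>P x)"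
proof -
  obtain f :: "nat \<Rightarrow> real \<Rightarrow> real" where f: "\<And>n. f n \<in> C0 E" "\<And>n y. y \<in> E \<Longrightarrow> 0 \<le> f n y"
    "\<And>y. y \<in> E \<Longrightarrow> incseq (\<lambda>n. f n y)" "\<And>y. y \<in> E \<Longrightarrow> (\<lambda>n. f n y) \<longlonglongrightarrow> c y"
    using C0_approximation[OF c c0] by blast
  have s: "(\<integral>\<^sup>+\<omega>. tail_cost X q c (T \<omega>) \<omega> \<partial>P y) = (SUP n. \<integral>\<^sup>+\<omega>. tail_cost X q (f n) (T \<omega>) \<omega> \<partial>P y)"
    "incseq (\<lambda>n. \<integral>\<^sup>+\<omega>. tail_cost X q (f n) (T \<omega>) \<omega> \<partial>P y)"
    if "y \<in> E" "T \<in> borel_measurable M" for y T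
    using that by (auto intro!: total_cost_SUP C0_measurable f)
  have U: "total_cost P X q c y = (SUP n. total_cost P X q (f n) y)"
      "incseq (\<lambda>n. total_cost P X q (f n) y)" if "y \<in> E" for y
    unfolding total_cost_def cost_top_eq_tail using that by (auto intro!: s)
  have mU: "total_cost P X q (f n) \<in> borel_measurable borel_E" for n
    by (intro total_cost_measurable_C0 f)
  have "(\<lambda>y. SUP n. total_cost P X q (f n) y) \<in> borel_measurable borel_E"
    using mU by measurable
  then show "total_cost P X q c \<in> borel_measurable borel_E"
    by (rule measurable_cong[THEN iffD2, rotated]) (simp add: U)
  show "(\<integral>\<^sup>+\<omega>. tail_cost X q c (T \<omega>) \<omega> \<partial>P x) =
      (\<integral>\<^sup>+\<omega>. ennreal (discount q (T \<omega>)) * total_cost P X q c (X (enn2real (T \<omega>)) \<omega>) \<partial>P x)"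
    if T: "stopping_time F T" and x: "x \<in> E"
  proof -
    have [measurable]: "T \<in> borel_measurable M" by (rule measurable_T[OF T])
    have E: "X (enn2real (T \<omega>)) \<omega> \<in> E" if "\<omega> \<in> space M" for \<omega> using that by (intro range_X) auto
    have "(\<integral>\<^sup>+\<omega>. tail_cost X q c (T \<omega>) \<omega> \<partial>P x) = (SUP n. \<integral>\<^sup>+\<omega>. tail_cost X q (f n) (T \<omega>) \<omega> \<partial>P x)"
      by (rule s(1)[OF x]) measurable
    also have "\<dots> = (SUP n. \<integral>\<^sup>+\<omega>. ennreal (discount q (T \<omega>)) *
        total_cost P X q (f n) (X (enn2real (T \<omega>)) \<omega>) \<partial>P x)"
      by (intro arg_cong[where f = Sup] image_cong refl strong_markov_C0 q f T x)
    also have "\<dots> = (\<integral>\<^sup>+\<omega>. (SUP n. ennreal (discount q (T \<omega>)) *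
        total_cost P X q (f n) (X (enn2real (T \<omega>)) \<omega>)) \<partial>P x)"
    proof (rule nn_integral_monotone_convergence_SUP_AE[symmetric])
      show "AE \<omega> in P x. ennreal (discount q (T \<omega>)) * total_cost P X q (f n) (X (enn2real (T \<omega>)) \<omega>)
          \<le> ennreal (discount q (T \<omega>)) * total_cost P X q (f (Suc n)) (X (enn2real (T \<omega>)) \<omega>)" for n
        using U(2)[OF E] by (intro AE_I2 mult_left_mono) (auto simp: incseq_Suc_iff space_P x)
      show "(\<lambda>\<omega>. ennreal (discount q (T \<omega>)) * total_cost P X q (f n) (X (enn2real (T \<omega>)) \<omega>))
          \<in> borel_measurable (P x)" for n
        using mU[measurable] by (intro measurable_P_borel x) measurable
    qed
    also have "\<dots> = (\<integral>\<^sup>+\<omega>. ennreal (discount q (T \<omega>)) * total_cost P X q c (X (enn2real (T \<omega>)) \<omega>) \<partial>P x)"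
      by (intro nn_integral_cong) (simp add: U(1)[OF E] space_P x SUP_mult_left_ennreal)
    finally show ?thesis .
  qed
qed

end

section \<open>Hitting times of upper half-lines\<close>

lemma discount_antimono: "0 < q \<Longrightarrow> s \<le> t \<Longrightarrow> discount q t \<le> discount q s"
  by (cases s; cases t) (auto simp: discount_def top_unique)

text \<open>The discount is a bounded coding of times, infinity included. Comparing expectations
  yields equality of discounts, and injectivity reads it back as equality of times.\<close>

lemma discount_inj: "0 < q \<Longrightarrow> discount q s = discount q t \<longleftrightarrow> s = t"
  by (cases s; cases t) (auto simp: discount_def)

lemma discount_0 [simp]: "discount q 0 = 1"
  by (simp add: discount_def)

lemma first_time_less_iff: "first_time X A \<omega> < s \<longleftrightarrow> (\<exists>t>0. X t \<omega> \<in> A \<and> ennreal t < s)"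
  unfolding first_time_def Inf_less_iff by auto

lemma first_time_le: "0 < t \<Longrightarrow> X t \<omega> \<in> A \<Longrightarrow> first_time X A \<omega> \<le> ennreal t"
  unfolding first_time_def by (intro Inf_lower) auto

lemma first_time_mono: "A \<subseteq> B \<Longrightarrow> first_time X B \<omega> \<le> first_time X A \<omega>"
  unfolding first_time_def by (intro Inf_superset_mono) auto

context feller_process
begin

section \<open>Position of the path at the entrance into a half-line\<close>

lemma path_eventually_right:
  assumes "open A" "0 \<le> t" "\<omega> \<in> space M" "X t \<omega> \<in> A"
  obtains b where "t < b" "\<And>s. t < s \<Longrightarrow> s < b \<Longrightarrow> X s \<omega> \<in> A"
proof -
  have "eventually (\<lambda>s. X s \<omega> \<in> A) (at_right t)"
    using topological_tendstoD[OF cadlag_right] assms by blast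
  then show ?thesis using that by (auto simp: eventually_at_right_field)
qed

text \<open>A path below \<open>u\<close> at time \<open>t\<close> would stay below \<open>u\<close>
  on an interval to the right of \<open>t\<close>, which contradicts \<open>t\<close> being the
  infimum. The argument also covers \<open>t = 0\<close>, although time 0 itself does not count in
  \<open>first_time\<close>.\<close>

lemma first_time_atLeast:
  assumes \<omega>: "\<omega> \<in> space M" and t: "0 \<le> t" and T: "first_time X {u..} \<omega> = ennreal t"
  shows "u \<le> X t \<omega>"
proof (rule ccontr)
  assume "\<not> u \<le> X t \<omega>"
  then have lt: "X t \<omega> \<in> {..<u}" by simp
  then obtain b where b: "t < b" "\<And>s. t < s \<Longrightarrow> s < b \<Longrightarrow> X s \<omega> \<in> {..<u}"
    using path_eventually_right[OF open_lessThan t \<omega>] by blast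
  have "first_time X {u..} \<omega> < ennreal b" using T b t by (simp add: ennreal_less_iff)
  then obtain s where s: "0 < s" "u \<le> X s \<omega>" "ennreal s < ennreal b"
    by (auto simp: first_time_less_iff)
  have "ennreal t \<le> ennreal s" unfolding T[symmetric] by (rule first_time_le) (use s in auto)
  then have "t \<le> s" using s by simp
  moreover have "s < b" using s by (simp add: ennreal_less_iff)
  ultimately show False using b(2)[of s] lt s(2) by (cases "t = s") auto
qed

text \<open>One null set serves all times, so the conclusion can be used at random times. Stating it
  for any left limit \<open>l\<close> removes \<open>Lim\<close> from later arguments.\<close>

lemma AE_no_upward_jump:
  assumes neg: "spectrally_negative E P X" and y: "y \<in> E"
  shows "AE \<omega> in P y. \<forall>t>0. \<forall>l. ((\<lambda>s. X s \<omega>) \<longlongrightarrow> l) (at_left t) \<longrightarrow> X t \<omega> \<le> l"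
proof -
  have "AE \<omega> in P y. \<not> (SUP t\<in>{0..}. ereal (jump X t \<omega>)) > 0"
    using neg y by (simp add: spectrally_negative_def)
  then show ?thesis
  proof (eventually_elim, intro allI impI)
    fix \<omega> t l assume le: "\<not> (SUP t\<in>{0..}. ereal (jump X t \<omega>)) > 0" and t: "0 < (t::real)"
      and l: "((\<lambda>s. X s \<omega>) \<longlongrightarrow> l) (at_left t)"
    have "ereal (jump X t \<omega>) \<le> (SUP t\<in>{0..}. ereal (jump X t \<omega>))"
      using t by (intro SUP_upper) auto
    then have "ereal (jump X t \<omega>) \<le> 0" using le by (meson not_less order_trans)
    then have "jump X t \<omega> \<le> 0" by simp
    moreover have "Lim (at_left t) (\<lambda>s. X s \<omega>) = l"
      by (rule tendsto_Lim[OF _ l]) simp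
    ultimately show "X t \<omega> \<le> l" using t by (simp add: jump_def)
  qed
qed

text \<open>At a positive entrance time the left limit is at most \<open>u\<close>, and without an
  upward jump so is the value, while right continuity gives at least \<open>u\<close>. At entrance
  time 0 the start must be \<open>u\<close> itself, and regularity of the point for itself makes the
  hitting time of \<open>u\<close> equal to 0 too.\<close>

lemma AE_first_time_atLeast:
  assumes reg: "regular_process E P X" and neg: "spectrally_negative E P X"
    and y: "y \<in> E" and u: "u \<in> E" and yu: "y \<le> u"
  shows "AE \<omega> in P y. first_time X {u} \<omega> = first_time X {u..} \<omega> \<and>
    (first_time X {u..} \<omega> < \<infinity> \<longrightarrow> X (enn2real (first_time X {u..} \<omega>)) \<omega> = u)"
proof -
  have "AE \<omega> in P y. first_time X {y} \<omega> = 0" using reg y by (simp add: regular_process_def)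
  with AE_no_upward_jump[OF neg y] start[OF y] AE_space[of "P y"] show ?thesis
  proof eventually_elim
    case (elim \<omega>)
    then have \<omega>: "\<omega> \<in> space M" by (simp add: space_P y)
    let ?T = "first_time X {u..} \<omega>"
    have le: "?T \<le> first_time X {u} \<omega>" by (intro first_time_mono) auto
    show ?case
    proof (cases ?T)
      case top
      then show ?thesis using le by (simp add: top_unique)
    next
      case (real t)
      have ge: "u \<le> X t \<omega>" by (rule first_time_atLeast[OF \<omega> real])
      show ?thesis
      proof (cases "t = 0")
        case True
        then have "y = u" using ge elim yu by simp
        then show ?thesis using real elim True by simp
      next
        case False
        then have t: "0 < t" using real by simp
        obtain l where l: "((\<lambda>s. X s \<omega>) \<longlongrightarrow> l) (at_left t)" using cadlag_left[OF t \<omega>] by blast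
        have "X s \<omega> \<le> u" if "0 < s" "s < t" for s
        proof (rule ccontr)
          assume "\<not> X s \<omega> \<le> u"
          then have "ennreal t \<le> ennreal s" unfolding real(2)[symmetric] using that by (intro first_time_le) auto
          then show False using that by simp
        qed
        then have "eventually (\<lambda>s. X s \<omega> \<le> u) (at_left t)"
          using t by (auto simp: eventually_at_left_field)
        then have "l \<le> u" using tendsto_upperbound[OF l] by simp
        then have X: "X t \<omega> = u" using elim(1) t l ge by fastforce
        have "first_time X {u} \<omega> \<le> ennreal t" by (rule first_time_le) (use t X in auto)
        then have "first_time X {u} \<omega> = ennreal t" using le real by (intro antisym) simp_all
        then show ?thesis using real X t by simp
      qed
    qed
  qed
qed

section \<open>The stopping time property of entrance times\<close>

text \<open>Right continuity of the filtration: the event that \<open>T\<close> is at most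
  \<open>t\<close> is a countable intersection of strict events at times decreasing to
  \<open>t\<close>, and so belongs to every later sigma-algebra.\<close>

lemma stopping_time_of_less:
  fixes T :: "'a \<Rightarrow> ennreal"
  assumes less: "\<And>s. 0 < s \<Longrightarrow> {\<omega> \<in> space M. T \<omega> < ennreal s} \<in> sets (F (ennreal s))"
  shows "stopping_time F T"
proof
  fix t :: ennreal
  show "Measurable.pred (F t) (\<lambda>\<omega>. T \<omega> \<le> t)"
  proof (cases t)
    case top
    then show ?thesis by simp
  next
    case (real r)
    have "{\<omega> \<in> space M. T \<omega> \<le> t} \<in> sets (F s)" if ts: "t < s" for s
    proof -
      \<comment> \<open>Since \<open>s\<close> may be infinite, an intermediate point is taken; it
        is finite and supplies the real bound \<open>v\<close> for the decreasing sequence.\<close>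
      obtain s' where s': "t < s'" "s' < s" using dense[OF ts] by blast
      then obtain v where v: "s' = ennreal v" "r < v"
        using real by (cases s') (auto simp: ennreal_less_iff)
      define d where "d n = r + (v - r) / real (Suc n)" for n
      have d: "r < d n" "d n \<le> v" for n
        using v(2) divide_left_mono[of 1 "real (Suc n)" "v - r"] by (auto simp: d_def)
      have "(\<lambda>n. r + (v - r) * (1 / real (Suc n))) \<longlonglongrightarrow> r + (v - r) * 0"
        by (intro tendsto_intros LIMSEQ_Suc[OF lim_1_over_n])
      then have lim: "d \<longlonglongrightarrow> r" by (simp add: d_def[abs_def])
      have "T \<omega> \<le> t \<longleftrightarrow> (\<forall>n. T \<omega> < ennreal (d n))" for \<omega>
      proof
        assume "T \<omega> \<le> t"
        then show "\<forall>n. T \<omega> < ennreal (d n)"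
          using d(1) real by (auto intro!: le_less_trans[of "T \<omega>" t] simp: ennreal_less_iff)
      next
        assume "\<forall>n. T \<omega> < ennreal (d n)"
        moreover have "(\<lambda>n. ennreal (d n)) \<longlonglongrightarrow> ennreal r" using lim by (rule tendsto_ennrealI)
        ultimately show "T \<omega> \<le> t" unfolding real(2)
          by (intro LIMSEQ_le_const) (auto intro: less_imp_le)
      qed
      then have "{\<omega> \<in> space M. T \<omega> \<le> t} = (\<Inter>n. {\<omega> \<in> space M. T \<omega> < ennreal (d n)})" by auto
      also have "\<dots> \<in> sets (F s)"
      proof (rule sets.countable_INT, rule image_subsetI)
        fix n
        have "0 < d n" using d(1)[of n] real by linarith
        then have "{\<omega> \<in> space M. T \<omega> < ennreal (d n)} \<in> sets (F (ennreal (d n)))" by (rule less)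
        moreover have "ennreal (d n) \<le> s"
          using d(2)[of n] v s' by (meson ennreal_leI less_imp_le order_trans)
        ultimately show "{\<omega> \<in> space M. T \<omega> < ennreal (d n)} \<in> sets (F s)"
          using sets_F_mono by blast
      qed simp
      finally show ?thesis .
    qed
    moreover have "sets (F t) = (\<Inter>s\<in>{t<..}. sets (F s))" using right_continuous real by simp
    ultimately have "{\<omega> \<in> space M. T \<omega> \<le> t} \<in> sets (F t)" by auto
    then show ?thesis by (simp add: pred_def space_F)
  qed
qed

text \<open>The half-line is open and the path right-continuous, so a visit before \<open>s\<close>
  persists for a while and is seen at a rational time before \<open>s\<close>. A visit to a closed
  half-line may last a single instant.\<close>

lemma stopping_time_greaterThan: "stopping_time F (first_time X {a<..})"
proof (rule stopping_time_of_less)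
  fix s :: real assume "0 < s"
  have "{\<omega> \<in> space M. first_time X {a<..} \<omega> < ennreal s} =
      (\<Union>r\<in>{r \<in> \<rat>. 0 < r \<and> r < s}. {\<omega> \<in> space M. a < X r \<omega>})"
  proof (intro subset_antisym subsetI)
    fix \<omega> assume "\<omega> \<in> {\<omega> \<in> space M. first_time X {a<..} \<omega> < ennreal s}"
    then obtain t where \<omega>: "\<omega> \<in> space M" and t: "0 < t" "X t \<omega> \<in> {a<..}" "t < s"
      by (auto simp: first_time_less_iff ennreal_less_iff)
    obtain b where b: "t < b" "\<And>s. t < s \<Longrightarrow> s < b \<Longrightarrow> X s \<omega> \<in> {a<..}"
      using path_eventually_right[OF open_greaterThan less_imp_le[OF t(1)] \<omega> t(2)] by blast
    obtain r where r: "r \<in> \<rat>" "t < r" "r < min b s"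
      using Rats_dense_in_real[of t "min b s"] b t by auto
    then have "r \<in> {r \<in> \<rat>. 0 < r \<and> r < s}" "a < X r \<omega>" using b(2)[of r] t by auto
    then show "\<omega> \<in> (\<Union>r\<in>{r \<in> \<rat>. 0 < r \<and> r < s}. {\<omega> \<in> space M. a < X r \<omega>})" using \<omega> by blast
  next
    fix \<omega> assume "\<omega> \<in> (\<Union>r\<in>{r \<in> \<rat>. 0 < r \<and> r < s}. {\<omega> \<in> space M. a < X r \<omega>})"
    then show "\<omega> \<in> {\<omega> \<in> space M. first_time X {a<..} \<omega> < ennreal s}"
      by (auto simp: first_time_less_iff ennreal_less_iff)
  qed
  also have "\<dots> \<in> sets (F (ennreal s))"
  proof (rule sets.countable_UN'')
    show "countable {r \<in> \<rat>. 0 < r \<and> r < s}" by (rule countable_subset[OF _ countable_rat]) auto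
    show "{\<omega> \<in> space M. a < X r \<omega>} \<in> sets (F (ennreal s))" if r: "r \<in> {r \<in> \<rat>. 0 < r \<and> r < s}" for r
    proof -
      have "X r \<in> borel_measurable (F (ennreal r))" using r by (intro adapted) auto
      then have "{\<omega> \<in> space (F (ennreal r)). a < X r \<omega>} \<in> sets (F (ennreal r))" by measurable
      moreover have "ennreal r \<le> ennreal s" using r by (intro ennreal_leI) auto
      ultimately show ?thesis using sets_F_mono by (auto simp: space_F)
    qed
  qed
  finally show "{\<omega> \<in> space M. first_time X {a<..} \<omega> < ennreal s} \<in> sets (F (ennreal s))" .
qed

lemma stopping_time_SUP:
  fixes T :: "nat \<Rightarrow> 'a \<Rightarrow> ennreal"
  assumes "\<And>n. stopping_time F (T n)"
  shows "stopping_time F (\<lambda>\<omega>. SUP n. T n \<omega>)"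
  using assms unfolding stopping_time_def SUP_le_iff by (auto intro!: pred_intros_countable)

text \<open>\<open>T\<close> is not known to be measurable, so the set where it differs from
  \<open>S\<close> is only assumed to lie inside a measurable set \<open>N\<close> that is null
  under all the laws. Completeness of \<open>F 0\<close> puts every subset of it into each
  \<open>F t\<close>.\<close>

lemma stopping_time_modification:
  fixes S T :: "'a \<Rightarrow> ennreal"
  assumes S: "stopping_time F S" and N: "N \<in> sets M" "\<And>y. y \<in> E \<Longrightarrow> emeasure (P y) N = 0"
    and sub: "{\<omega> \<in> space M. T \<omega> \<noteq> S \<omega>} \<subseteq> N"
  shows "stopping_time F T"
proof
  fix t :: ennreal
  let ?D = "{\<omega> \<in> space M. T \<omega> \<noteq> S \<omega>}"
  have null: "A \<in> sets (F t)" if "A \<subseteq> ?D" for A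
    using complete[OF _ N, of A] that sub sets_F_mono[of 0 t] by auto
  have "{\<omega> \<in> space M. S \<omega> \<le> t} \<in> sets (F t)"
    using stopping_timeD[OF S] by (simp add: pred_def space_F)
  then have "({\<omega> \<in> space M. S \<omega> \<le> t} - ?D) \<union> ({\<omega> \<in> space M. T \<omega> \<le> t} \<inter> ?D) \<in> sets (F t)"
    by (intro sets.Un[OF sets.Diff[OF _ null] null]) auto
  also have "({\<omega> \<in> space M. S \<omega> \<le> t} - ?D) \<union> ({\<omega> \<in> space M. T \<omega> \<le> t} \<inter> ?D) = {\<omega> \<in> space M. T \<omega> \<le> t}"
    by auto
  finally show "Measurable.pred (F t) (\<lambda>\<omega>. T \<omega> \<le> t)" by (simp add: pred_def space_F)
qed

end

locale spectrally_negative_process = feller_process +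
  fixes q :: real and h :: "real \<Rightarrow> real"
  assumes regular: "regular_process E P X"
    and spec_neg: "spectrally_negative E P X"
    and q_pos: "0 < q"
    and q_function: "increasing_q_function E P X q h"
begin

lemma h_mono: "y \<in> E \<Longrightarrow> z \<in> E \<Longrightarrow> y \<le> z \<Longrightarrow> h y \<le> h z"
  using q_function by (auto simp: increasing_q_function_def mono_on_def)

lemma h_pos: "y \<in> E \<Longrightarrow> 0 < h y"
  using q_function by (auto simp: increasing_q_function_def)

lemma h_hitting: "y \<in> E \<Longrightarrow> z \<in> E \<Longrightarrow> y \<le> z \<Longrightarrow>
    (\<integral>\<omega>. discount q (first_time X {z} \<omega>) \<partial>P y) = h y / h z"
  using q_function by (auto simp: increasing_q_function_def)

lemma h_left_limit:
  assumes u: "u \<in> E" and z: "\<And>n. z n \<in> E" "\<And>n. z n \<le> u" "z \<longlonglongrightarrow> u"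
  shows "(\<lambda>n. h (z n)) \<longlonglongrightarrow> h u"
proof -
  have "continuous (at u within (E \<inter> {..u})) h"
    using q_function u by (simp add: increasing_q_function_def)
  then show ?thesis
    unfolding continuous_within_sequentially using z by (auto simp: comp_def)
qed

text \<open>Measurability is implicit in the defining identity of \<open>h\<close>: the Bochner integral of a
  function that is not measurable is \<open>0\<close>.\<close>

lemma measurable_discount_hitting:
  assumes u: "u \<in> E"
  shows "(\<lambda>\<omega>. discount q (first_time X {u} \<omega>)) \<in> borel_measurable M"
proof -
  have "(\<integral>\<omega>. discount q (first_time X {u} \<omega>) \<partial>P u) \<noteq> 0"
    using h_hitting[OF u u] h_pos[OF u] by simp
  then have "integrable (P u) (\<lambda>\<omega>. discount q (first_time X {u} \<omega>))"
    using not_integrable_integral_eq by blast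
  then show ?thesis using measurable_P_iff[OF u] by (auto dest: borel_measurable_integrable)
qed

lemma integrable_discount:
  assumes "y \<in> E" "(\<lambda>\<omega>. discount q (T \<omega>)) \<in> borel_measurable M"
  shows "integrable (P y) (\<lambda>\<omega>. discount q (T \<omega>))"
proof -
  interpret prob_space "P y" by (rule prob_P) fact
  show ?thesis
    by (rule integrable_const_bound[where B = 1])
      (use assms in \<open>auto simp: discount_le_1 q_pos intro: measurable_P_borel\<close>)
qed

text \<open>Left continuity of \<open>h\<close> replaces quasi-left-continuity of \<open>X\<close>: the entrance times into
  \<open>(z n, \<infinity>)\<close> increase to a time that is at most the hitting time of \<open>u\<close>, and
  both have the same discounted expectation.\<close>

lemma entrance_time_approximation:
  assumes u: "u \<in> E"
  obtains R where "stopping_time F R" "\<And>\<omega>. R \<omega> \<le> first_time X {u..} \<omega>"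
    "\<And>y. y \<in> E \<Longrightarrow> y < u \<Longrightarrow> AE \<omega> in P y. discount q (first_time X {u} \<omega>) = discount q (R \<omega>)"
proof (cases "\<exists>y\<in>E. y < u")
  case False
  \<comment> \<open>With no point of \<open>E\<close> below \<open>u\<close> the last property is
    vacuous, and the zero time is a valid choice.\<close>
  then show ?thesis by (intro that[of "\<lambda>_. 0"]) (auto simp: stopping_time_const)
next
  case True
  then obtain y0 where y0: "y0 \<in> E" "y0 < u" by blast
  define z where "z n = u - (u - y0) / real (Suc n)" for n
  have z: "y0 \<le> z n" "z n < u" for n
    using y0 divide_left_mono[of 1 "real (Suc n)" "u - y0"] by (auto simp: z_def)
  have zE: "z n \<in> E" for n
    using mem_is_interval_1_I[OF interval(1) y0(1) u, of "z n"] z[of n] by auto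
  have "(\<lambda>n. u - (u - y0) * (1 / real (Suc n))) \<longlonglongrightarrow> u - (u - y0) * 0"
    by (intro tendsto_intros LIMSEQ_Suc[OF lim_1_over_n])
  then have zlim: "z \<longlonglongrightarrow> u" by (simp add: z_def[abs_def])
  define R where "R \<omega> = (SUP n. first_time X {z n<..} \<omega>)" for \<omega>
  have R: "stopping_time F R"
    unfolding R_def by (intro stopping_time_SUP stopping_time_greaterThan)
  have Rle: "R \<omega> \<le> first_time X {u..} \<omega>" for \<omega>
    unfolding R_def using z(2) by (intro SUP_least first_time_mono) (auto intro: less_le_trans)
  have dR: "(\<lambda>\<omega>. discount q (R \<omega>)) \<in> borel_measurable M"
    using measurable_T[OF R] by measurable
  show ?thesis
  proof (rule that[OF R Rle])
    fix y assume y: "y \<in> E" "y < u"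
    interpret prob_space "P y" by (rule prob_P[OF y(1)])
    note iR = integrable_discount[OF y(1) dR]
    note iu = integrable_discount[OF y(1) measurable_discount_hitting[OF u]]
    have "(\<lambda>n. h y / h (z n)) \<longlonglongrightarrow> h y / h u"
      using h_pos[OF u] by (intro tendsto_divide tendsto_const h_left_limit u zE zlim less_imp_le[OF z(2)]) auto
    moreover have "eventually (\<lambda>n. (\<integral>\<omega>. discount q (R \<omega>) \<partial>P y) \<le> h y / h (z n)) sequentially"
      using order_tendstoD(1)[OF zlim y(2)]
    proof eventually_elim
      case (elim n)
      note yz = less_imp_le[OF elim]
      \<comment> \<open>From a start at or below \<open>z n\<close> the point is hit at the entrance
        into the closed half-line, hence no later than the entrance into the open one. This holds
        only once \<open>y \<le> z n\<close>, so the estimate is an eventual one.\<close>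
      have "AE \<omega> in P y. discount q (R \<omega>) \<le> discount q (first_time X {z n} \<omega>)"
        using AE_first_time_atLeast[OF regular spec_neg y(1) zE yz]
      proof eventually_elim
        case (elim \<omega>)
        have "first_time X {z n} \<omega> = first_time X {z n..} \<omega>" using elim by simp
        also have "\<dots> \<le> first_time X {z n<..} \<omega>" by (intro first_time_mono) auto
        also have "\<dots> \<le> R \<omega>" unfolding R_def by (rule SUP_upper) simp
        finally show ?case by (intro discount_antimono q_pos)
      qed
      then have "(\<integral>\<omega>. discount q (R \<omega>) \<partial>P y) \<le> (\<integral>\<omega>. discount q (first_time X {z n} \<omega>) \<partial>P y)"
        by (intro integral_mono_AE iR integrable_discount y measurable_discount_hitting zE)
      then show ?case by (simp add: h_hitting y zE yz)
    qed
    ultimately have "(\<integral>\<omega>. discount q (R \<omega>) \<partial>P y) \<le> h y / h u"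
      by (rule tendsto_lowerbound) simp
    then have le: "(\<integral>\<omega>. discount q (R \<omega>) \<partial>P y) \<le> (\<integral>\<omega>. discount q (first_time X {u} \<omega>) \<partial>P y)"
      using h_hitting[OF y(1) u] y by simp
    have pt: "discount q (first_time X {u} \<omega>) \<le> discount q (R \<omega>)" for \<omega>
    proof (intro discount_antimono q_pos)
      show "R \<omega> \<le> first_time X {u} \<omega>"
        using Rle[of \<omega>] first_time_mono[of "{u}" "{u..}" X \<omega>] by (auto intro: order_trans)
    qed
    \<comment> \<open>The difference is nonnegative pathwise, and by left continuity of
      \<open>h\<close> its expectation is not positive; so it vanishes almost surely.\<close>
    have "(\<integral>\<omega>. discount q (R \<omega>) - discount q (first_time X {u} \<omega>) \<partial>P y) = 0"
    proof (rule antisym)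
      show "(\<integral>\<omega>. discount q (R \<omega>) - discount q (first_time X {u} \<omega>) \<partial>P y) \<le> 0"
        using le iR iu by simp
      show "0 \<le> (\<integral>\<omega>. discount q (R \<omega>) - discount q (first_time X {u} \<omega>) \<partial>P y)"
        using pt by (intro Bochner_Integration.integral_nonneg) simp
    qed
    then have "AE \<omega> in P y. discount q (R \<omega>) - discount q (first_time X {u} \<omega>) = 0"
      using integral_nonneg_eq_0_iff_AE[of "P y" "\<lambda>\<omega>. discount q (R \<omega>) - discount q (first_time X {u} \<omega>)"]
        iR iu pt by simp
    then show "AE \<omega> in P y. discount q (first_time X {u} \<omega>) = discount q (R \<omega>)"
      by eventually_elim simp
  qed
qed

text \<open>The time lies between \<open>R\<close> and the hitting time of the point
  \<open>u\<close>. From a start below \<open>u\<close> these agree almost surely; from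
  \<open>u\<close> the hitting time is almost surely 0; from above \<open>u\<close> the time is 0 on
  every path.\<close>

lemma stopping_time_first_time:
  assumes u: "u \<in> E"
  shows "stopping_time F (first_time X {u..})"
proof -
  obtain R where R: "stopping_time F R" "\<And>\<omega>. R \<omega> \<le> first_time X {u..} \<omega>"
    "\<And>y. y \<in> E \<Longrightarrow> y < u \<Longrightarrow> AE \<omega> in P y. discount q (first_time X {u} \<omega>) = discount q (R \<omega>)"
    using entrance_time_approximation[OF u] by blast
  note [measurable] = measurable_discount_hitting[OF u] measurable_T[OF R(1)]
  have [measurable]: "X 0 \<in> borel_measurable M" by (rule measurable_FD[OF adapted]) simp
  \<comment> \<open>Splitting by \<open>X 0\<close> yields a single set for all the laws: under
    \<open>P y\<close> only the part matching \<open>y\<close> can carry mass. Discounts appear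
    instead of times because it is the discounted hitting time whose measurability has been
    obtained.\<close>
  define N where "N = {\<omega> \<in> space M. X 0 \<omega> < u \<and> discount q (first_time X {u} \<omega>) \<noteq> discount q (R \<omega>)} \<union>
      {\<omega> \<in> space M. X 0 \<omega> = u \<and> discount q (first_time X {u} \<omega>) \<noteq> 1}"
  have N: "N \<in> sets M" unfolding N_def by measurable
  show ?thesis
  proof (rule stopping_time_modification[OF R(1) N])
    fix y assume y: "y \<in> E"
    have "AE \<omega> in P y. first_time X {y} \<omega> = 0" using regular y by (simp add: regular_process_def)
    moreover have "AE \<omega> in P y. y < u \<longrightarrow> discount q (first_time X {u} \<omega>) = discount q (R \<omega>)"
      using R(3)[OF y] by (cases "y < u") auto
    ultimately have "AE \<omega> in P y. \<omega> \<notin> N"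
      using start[OF y] by eventually_elim (auto simp: N_def)
    then show "emeasure (P y) N = 0"
      using AE_iff_null_sets[of N "P y"] N by (simp add: sets_P y null_setsD1)
  next
    show "{\<omega> \<in> space M. first_time X {u..} \<omega> \<noteq> R \<omega>} \<subseteq> N"
    proof clarify
      fix \<omega> assume \<omega>: "\<omega> \<in> space M" and ne: "first_time X {u..} \<omega> \<noteq> R \<omega>"
      have lt: "R \<omega> < first_time X {u..} \<omega>" using ne R(2)[of \<omega>] by auto
      have le: "first_time X {u..} \<omega> \<le> first_time X {u} \<omega>" by (intro first_time_mono) auto
      consider "X 0 \<omega> < u" | "X 0 \<omega> = u" | "u < X 0 \<omega>" by linarith
      then show "\<omega> \<in> N"
      proof cases
        case 1
        have "first_time X {u} \<omega> \<noteq> R \<omega>" using lt le by auto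
        then show ?thesis using 1 \<omega> by (simp add: N_def discount_inj q_pos)
      next
        case 2
        have "first_time X {u} \<omega> \<noteq> 0" using lt le by (auto simp: not_less)
        then have "discount q (first_time X {u} \<omega>) \<noteq> 1"
          using discount_inj[OF q_pos, of _ 0] by simp
        then show ?thesis using 2 \<omega> by (simp add: N_def)
      next
        case 3
        then have "X 0 \<omega> \<in> {u<..}" by simp
        then obtain b where b: "0 < b" "\<And>s. 0 < s \<Longrightarrow> s < b \<Longrightarrow> X s \<omega> \<in> {u<..}"
          using path_eventually_right[OF open_greaterThan order_refl \<omega>] by blast
        have small: "first_time X {u..} \<omega> \<le> ennreal s" if "0 < s" for s
        proof -
          have "first_time X {u..} \<omega> \<le> ennreal (min s (b / 2))"
          proof (rule first_time_le)
            have "0 < min s (b / 2)" "min s (b / 2) < b" using b(1) that by auto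
            from b(2)[OF this] show "X (min s (b / 2)) \<omega> \<in> {u..}" by simp
          qed (use b(1) that in simp)
          also have "\<dots> \<le> ennreal s" by (intro ennreal_leI) simp
          finally show ?thesis .
        qed
        have "first_time X {u..} \<omega> \<le> 0"
        proof (rule ennreal_le_epsilon)
          show "first_time X {u..} \<omega> \<le> 0 + ennreal e" if "0 < e" for e :: real
            using small[OF that] by simp
        qed
        then show ?thesis using lt by simp
      qed
    qed
  qed
qed

end

section \<open>Superharmonicity of \<open>h\<close>\<close>

context feller_process
begin

text \<open>Nothing accrues before \<open>S\<close>, and at \<open>S\<close> itself the hypothesis
  is silent; but that is a single time and does not affect the integral.\<close>

lemma tail_cost_eq_of_zero_before:
  assumes zero: "\<And>s. 0 < s \<Longrightarrow> ennreal s < S \<Longrightarrow> f (X s \<omega>) = 0"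
  shows "tail_cost X q f S \<omega> = tail_cost X q f 0 \<omega>"
  unfolding tail_cost_def
proof (rule nn_integral_cong_AE)
  show "AE s in lborel. ennreal (f (X s \<omega>) * exp (- q * s)) * indicator {s. 0 \<le> s \<and> S < ennreal s} s =
      ennreal (f (X s \<omega>) * exp (- q * s)) * indicator {s. 0 \<le> s \<and> 0 < ennreal s} s"
    using AE_lborel_singleton[of "enn2real S"]
  proof eventually_elim
    case (elim s)
    show ?case
    proof (cases "0 < s \<and> \<not> S < ennreal s")
      case True
      then have "ennreal s \<noteq> S" using elim by auto
      then have "ennreal s < S" using True by auto
      then have "f (X s \<omega>) = 0" using zero True by blast
      then show ?thesis by simp
    next
      case False
      moreover have "0 < s" if "S < ennreal s" using le_less_trans[OF zero_le that] by simp
      ultimately have "s \<in> {s. 0 \<le> s \<and> S < ennreal s} \<longleftrightarrow> s \<in> {s. 0 \<le> s \<and> 0 < ennreal s}"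
        by auto
      then show ?thesis by (simp only: indicator_def)
    qed
  qed
qed

lemma measurable_stopped:
  fixes T :: "'a \<Rightarrow> ennreal"
  assumes [measurable]: "f \<in> borel_measurable borel_E" "T \<in> borel_measurable M" and y: "y \<in> E"
  shows "(\<lambda>\<omega>. discount q (T \<omega>) * f (X (enn2real (T \<omega>)) \<omega>)) \<in> borel_measurable (P y)"
  by (intro measurable_P_borel y) measurable

end

context spectrally_negative_process
begin

lemma h_measurable: "h \<in> borel_measurable borel_E"
  using q_function by (intro borel_measurable_mono_on_fnc) (simp add: increasing_q_function_def)

lemma AE_hitting:
  assumes "y \<in> E" "u \<in> E" "y \<le> u"
  shows "AE \<omega> in P y. first_time X {u} \<omega> = first_time X {u..} \<omega> \<and>
    (first_time X {u..} \<omega> < \<infinity> \<longrightarrow> X (enn2real (first_time X {u..} \<omega>)) \<omega> = u)"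
  by (rule AE_first_time_atLeast[OF regular spec_neg assms])

lemma integral_discount_first_time:
  assumes y: "y \<in> E" and u: "u \<in> E" and yu: "y \<le> u"
  shows "(\<integral>\<omega>. discount q (first_time X {u..} \<omega>) \<partial>P y) = h y / h u"
proof -
  have m: "(\<lambda>\<omega>. discount q (first_time X {u..} \<omega>)) \<in> borel_measurable (P y)"
    using measurable_T[OF stopping_time_first_time[OF u]] by (intro measurable_P_borel y) measurable
  have "(\<integral>\<omega>. discount q (first_time X {u..} \<omega>) \<partial>P y) = (\<integral>\<omega>. discount q (first_time X {u} \<omega>) \<partial>P y)"
    by (rule integral_cong_AE[OF m measurable_P_borel[OF measurable_discount_hitting[OF u] y]])
      (use AE_hitting[OF y u yu] in eventually_elim, simp)
  then show ?thesis by (simp add: h_hitting y u yu)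
qed

lemma nn_integral_discount_first_time:
  assumes y: "y \<in> E" and u: "u \<in> E" and yu: "y \<le> u"
  shows "(\<integral>\<^sup>+\<omega>. ennreal (discount q (first_time X {u..} \<omega>)) \<partial>P y) = ennreal (h y / h u)"
proof -
  have "(\<lambda>\<omega>. discount q (first_time X {u..} \<omega>)) \<in> borel_measurable M"
    using measurable_T[OF stopping_time_first_time[OF u]] by measurable
  then show ?thesis
    unfolding integral_discount_first_time[OF assms, symmetric]
    by (intro nn_integral_eq_integral integrable_discount y) simp_all
qed

text \<open>The potential of a function that vanishes below \<open>b\<close> is a multiple of \<open>h\<close> below \<open>b\<close>. This
  gives access to the strong Markov property for \<open>h\<close> without shift operators.\<close>

definition ramp :: "real \<Rightarrow> real \<Rightarrow> real" where
  "ramp b y = min 1 (max 0 (y - b))"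

lemma ramp_bounds: "0 \<le> ramp b y" "ramp b y \<le> 1" and ramp_zero: "y \<le> b \<Longrightarrow> ramp b y = 0"
  by (auto simp: ramp_def)

lemma continuous_ramp: "continuous_on A (ramp b)"
  unfolding ramp_def by (intro continuous_intros)

lemma ramp_measurable: "ramp b \<in> borel_measurable borel_E"
  by (intro borel_measurable_continuous_on_restrict continuous_ramp)

text \<open>Before the entrance into [b, \<infinity>) the running cost \<open>ramp b\<close>
  vanishes along the path, so the whole cost is the tail after \<open>S\<close>; the strong Markov
  property evaluates that tail.\<close>

lemma ramp_potential_stopped:
  assumes x: "x \<in> E" and S: "stopping_time F S" "\<And>\<omega>. S \<omega> \<le> first_time X {b..} \<omega>"
  shows "total_cost P X q (ramp b) x =
    (\<integral>\<^sup>+\<omega>. ennreal (discount q (S \<omega>)) * total_cost P X q (ramp b) (X (enn2real (S \<omega>)) \<omega>) \<partial>P x)"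
proof -
  have "total_cost P X q (ramp b) x = (\<integral>\<^sup>+\<omega>. tail_cost X q (ramp b) 0 \<omega> \<partial>P x)"
    unfolding total_cost_def cost_top_eq_tail ..
  also have "\<dots> = (\<integral>\<^sup>+\<omega>. tail_cost X q (ramp b) (S \<omega>) \<omega> \<partial>P x)"
  proof (rule nn_integral_cong, rule tail_cost_eq_of_zero_before[symmetric])
    fix \<omega> s assume s: "0 < s" "ennreal s < S \<omega>"
    then have "\<not> first_time X {b..} \<omega> \<le> ennreal s"
      using less_le_trans[OF s(2) S(2)] by (simp only: not_le)
    then have "X s \<omega> \<notin> {b..}" using first_time_le[OF s(1), of X \<omega> "{b..}"] by metis
    then show "ramp b (X s \<omega>) = 0" by (intro ramp_zero) simp
  qed
  also have "\<dots> = (\<integral>\<^sup>+\<omega>. ennreal (discount q (S \<omega>)) *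
      total_cost P X q (ramp b) (X (enn2real (S \<omega>)) \<omega>) \<partial>P x)"
    by (rule strong_markov[OF q_pos continuous_ramp ramp_bounds(1) S(1) x])
  finally show ?thesis .
qed

text \<open>Stopping at the entrance itself, the process sits at \<open>b\<close>, so the potential
  there is a constant, and the expected discount is the ratio of values of \<open>h\<close>.\<close>

lemma ramp_potential_proportional:
  assumes y: "y \<in> E" and b: "b \<in> E" and yb: "y \<le> b"
  shows "total_cost P X q (ramp b) y = total_cost P X q (ramp b) b * ennreal (h y / h b)"
proof -
  have S: "stopping_time F (first_time X {b..})" by (rule stopping_time_first_time[OF b])
  have "total_cost P X q (ramp b) y = (\<integral>\<^sup>+\<omega>. ennreal (discount q (first_time X {b..} \<omega>)) *
      total_cost P X q (ramp b) (X (enn2real (first_time X {b..} \<omega>)) \<omega>) \<partial>P y)"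
    by (rule ramp_potential_stopped[OF y S order_refl])
  also have "\<dots> = (\<integral>\<^sup>+\<omega>. ennreal (discount q (first_time X {b..} \<omega>)) * total_cost P X q (ramp b) b \<partial>P y)"
  proof (rule nn_integral_cong_AE)
    show "AE \<omega> in P y. ennreal (discount q (first_time X {b..} \<omega>)) *
      total_cost P X q (ramp b) (X (enn2real (first_time X {b..} \<omega>)) \<omega>) =
      ennreal (discount q (first_time X {b..} \<omega>)) * total_cost P X q (ramp b) b"
      using AE_hitting[OF y b yb]
    proof eventually_elim
      case (elim \<omega>)
      show ?case
      proof (cases "first_time X {b..} \<omega>")
        case top
        then show ?thesis by simp
      next
        case (real t)
        then have "first_time X {b..} \<omega> < \<infinity>" by simp
        then show ?thesis using elim by simp
      qed
    qed
  qed
  also have "\<dots> = (\<integral>\<^sup>+\<omega>. ennreal (discount q (first_time X {b..} \<omega>)) \<partial>P y) * total_cost P X q (ramp b) b"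
    using measurable_T[OF S] by (intro nn_integral_multc measurable_P_borel y) measurable
  finally show ?thesis by (simp add: nn_integral_discount_first_time y b yb mult.commute)
qed

lemma tail_cost_pos:
  assumes \<omega>: "\<omega> \<in> space M" and t: "0 < t" and bX: "b < X t \<omega>"
  shows "0 < tail_cost X q (ramp b) 0 \<omega>"
proof (rule ccontr)
  note [measurable] = measurable_path[OF \<omega>] ramp_measurable
  let ?f = "\<lambda>s. ennreal (ramp b (X (max 0 s) \<omega>) * exp (- q * s)) * indicator {0<..} s"
  assume "\<not> 0 < tail_cost X q (ramp b) 0 \<omega>"
  then have "(\<integral>\<^sup>+s. ?f s \<partial>lborel) = 0" unfolding cost_top_eq_tail[symmetric] cost_top_eq by simp
  then have ae: "AE s in lborel. ?f s = 0"
    by (subst (asm) nn_integral_0_iff_AE) measurable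
  obtain a where a: "t < a" "\<And>s. t < s \<Longrightarrow> s < a \<Longrightarrow> X s \<omega> \<in> {b<..}"
    using path_eventually_right[of "{b<..}" t \<omega>] t bX \<omega> by auto
  have "AE s in lborel. s \<notin> {t<..<a}"
    using ae
  proof eventually_elim
    case (elim s)
    show ?case
    proof
      assume s: "s \<in> {t<..<a}"
      then have "0 < ramp b (X s \<omega>)" using a(2)[of s] by (auto simp: ramp_def)
      then have "0 < ?f s" using s t by (simp add: max_def ennreal_zero_less_mult_iff)
      then show False by (simp only: elim less_irrefl)
    qed
  qed
  then have "{t<..<a} \<in> null_sets lborel" by (subst AE_iff_null_sets) auto
  then show False using a(1) by (auto simp: null_sets_def)
qed

text \<open>The bound \<open>1 / q\<close> comes from \<open>ramp b\<close> being at most 1.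
  Positivity comes from regularity: with positive probability the path reaches \<open>w\<close>, and
  right continuity then keeps it above \<open>b\<close> for a positive length of time.\<close>

lemma ramp_potential_finite_pos:
  assumes b: "b \<in> E" and w: "w \<in> E" "b < w"
  obtains \<kappa> where "0 < \<kappa>" "total_cost P X q (ramp b) b = ennreal \<kappa>"
proof -
  have le: "total_cost P X q (ramp b) b \<le> ennreal (1 / q)"
    by (intro total_cost_le q_pos ramp_measurable ramp_bounds b)
  have ne: "total_cost P X q (ramp b) b \<noteq> 0"
  proof
    let ?N = "{\<omega> \<in> space (P b). first_time X {w} \<omega> < \<infinity>}"
    assume "total_cost P X q (ramp b) b = 0"
    then have "(\<integral>\<^sup>+\<omega>. tail_cost X q (ramp b) 0 \<omega> \<partial>P b) = 0"
      unfolding total_cost_def cost_top_eq_tail .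
    moreover have "(\<lambda>\<omega>. tail_cost X q (ramp b) 0 \<omega>) \<in> borel_measurable (P b)"
      using measurable_path_cost(2)[OF ramp_measurable, of "\<lambda>_. 0"] by (intro measurable_P_borel b) simp
    ultimately have "AE \<omega> in P b. tail_cost X q (ramp b) 0 \<omega> = 0"
      by (simp add: nn_integral_0_iff_AE)
    then have "AE \<omega> in P b. \<not> first_time X {w} \<omega> < \<infinity>"
      using AE_space
    proof eventually_elim
      case (elim \<omega>)
      show ?case
      proof
        assume "first_time X {w} \<omega> < \<infinity>"
        then obtain t where "0 < t" "X t \<omega> = w" by (auto simp: first_time_less_iff)
        then show False using tail_cost_pos[of \<omega> t b] elim w by (simp add: space_P b)
      qed
    qed
    then have ae: "AE \<omega> in P b. \<omega> \<notin> ?N"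
      by eventually_elim auto
    have "measure (P b) ?N = 0"
    \<comment> \<open>A set outside the sigma-algebra has \<open>measure\<close> 0 by convention, so
      positivity of the measure is contradicted in either case.\<close>
    proof (cases "?N \<in> sets (P b)")
      case True
      then have "?N \<in> null_sets (P b)" using ae by (simp only: AE_iff_null_sets)
      then show ?thesis by (rule measure_eq_0_null_sets)
    qed (rule measure_notin_sets)
    moreover have "measure (P b) {\<omega> \<in> space (P b). first_time X {w} \<omega> < \<infinity>} > 0"
      using regular b w by (simp add: regular_process_def)
    ultimately show False by simp
  qed
  show ?thesis
  proof (rule that)
    show "total_cost P X q (ramp b) b = ennreal (enn2real (total_cost P X q (ramp b) b))"
      using le by (auto simp: ennreal_enn2real_if top_unique)
    show "0 < enn2real (total_cost P X q (ramp b) b)"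
      using le ne by (auto simp: enn2real_positive_iff zero_less_iff_neq_zero intro: le_less_trans)
  qed
qed

text \<open>Up to and including the entrance the process is at most \<open>b\<close>, where the
  potential is \<open>\<kappa> / h b\<close> times \<open>h\<close>; since this constant is positive
  and finite it cancels. The point \<open>w\<close> above \<open>b\<close> guarantees its
  positivity.\<close>

lemma h_martingale_until_hitting:
  assumes x: "x \<in> E" and b: "b \<in> E" and xb: "x \<le> b" and w: "w \<in> E" "b < w"
    and T: "stopping_time F T"
  defines "S \<equiv> \<lambda>\<omega>. min (T \<omega>) (first_time X {b..} \<omega>)"
  shows "(\<integral>\<^sup>+\<omega>. ennreal (discount q (S \<omega>) * h (X (enn2real (S \<omega>)) \<omega>)) \<partial>P x) = ennreal (h x)"
proof -
  have S: "stopping_time F S"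
    unfolding S_def by (intro stopping_time_min T stopping_time_first_time b)
  note mS = measurable_T[OF S]
  obtain \<kappa> where \<kappa>: "0 < \<kappa>" "total_cost P X q (ramp b) b = ennreal \<kappa>"
    using ramp_potential_finite_pos[OF b w] by blast
  have hb: "0 < h b" by (rule h_pos[OF b])
  have U: "total_cost P X q (ramp b) y = ennreal (\<kappa> / h b) * ennreal (h y)" if "y \<in> E" "y \<le> b" for y
    using ramp_potential_proportional[OF that(1) b that(2)] \<kappa> hb h_pos[OF that(1)]
    by (simp add: ennreal_mult[symmetric])
  have "ennreal (\<kappa> / h b) * ennreal (h x) = total_cost P X q (ramp b) x" by (simp add: U x xb)
  also have "\<dots> = (\<integral>\<^sup>+\<omega>. ennreal (discount q (S \<omega>)) * total_cost P X q (ramp b) (X (enn2real (S \<omega>)) \<omega>) \<partial>P x)"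
    by (rule ramp_potential_stopped[OF x S]) (simp add: S_def)
  also have "\<dots> = (\<integral>\<^sup>+\<omega>. ennreal (\<kappa> / h b) * ennreal (discount q (S \<omega>) * h (X (enn2real (S \<omega>)) \<omega>)) \<partial>P x)"
  proof (rule nn_integral_cong_AE)
    show "AE \<omega> in P x. ennreal (discount q (S \<omega>)) * total_cost P X q (ramp b) (X (enn2real (S \<omega>)) \<omega>) =
        ennreal (\<kappa> / h b) * ennreal (discount q (S \<omega>) * h (X (enn2real (S \<omega>)) \<omega>))"
      using AE_hitting[OF x b xb] start[OF x] AE_space
    proof eventually_elim
      case (elim \<omega>)
      then have \<omega>: "\<omega> \<in> space M" by (simp add: space_P x)
      show ?case
      proof (cases "S \<omega>")
        case top
        then show ?thesis by simp
      next
        case (real s)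
        have XE: "X s \<omega> \<in> E" by (rule range_X[OF real(1) \<omega>])
        have "X s \<omega> \<le> b"
        proof (cases "S \<omega> = first_time X {b..} \<omega>")
          case True
          then have "first_time X {b..} \<omega> = ennreal s" using real by simp
          then show ?thesis using elim(1) real(1) by simp
        next
          case False
          then have lt: "ennreal s < first_time X {b..} \<omega>"
            using real by (auto simp: S_def min_def split: if_splits)
          show ?thesis
          \<comment> \<open>\<open>first_time\<close> ignores time 0, so at \<open>s = 0\<close> the
            bound has to come from the starting point.\<close>
          proof (cases "s = 0")
            case True
            then show ?thesis using elim xb by simp
          next
            case False
            then have "X s \<omega> \<notin> {b..}" using lt real first_time_le[of s X \<omega> "{b..}"] by auto
            then show ?thesis by simp
          qed
        qed
        then have "total_cost P X q (ramp b) (X s \<omega>) = ennreal (\<kappa> / h b) * ennreal (h (X s \<omega>))"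
          by (rule U[OF XE])
        then show ?thesis
          using real h_pos[OF XE] by (simp add: ennreal_mult less_imp_le mult_ac)
      qed
    qed
  qed
  also have "\<dots> = ennreal (\<kappa> / h b) *
      (\<integral>\<^sup>+\<omega>. ennreal (discount q (S \<omega>) * h (X (enn2real (S \<omega>)) \<omega>)) \<partial>P x)"
    by (intro nn_integral_cmult measurable_compose[OF measurable_stopped measurable_ennreal] h_measurable mS x)
  finally show ?thesis
    using \<kappa>(1) hb by (subst (asm) ennreal_mult_cancel_left) auto
qed

text \<open>If the entrance into [b, \<infinity>) comes before \<open>T\<close>, stopping there pays
  \<open>h b\<close> with the smaller time discount loss, which dominates the truncated value at
  \<open>T\<close>; otherwise nothing changes. So the stopped identity dominates the integrand
  almost surely.\<close>

lemma h_truncated_superharmonic: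
  assumes x: "x \<in> E" and b: "b \<in> E" and xb: "x \<le> b" and w: "w \<in> E" "b < w"
    and T: "stopping_time F T"
  shows "(\<integral>\<^sup>+\<omega>. ennreal (discount q (T \<omega>) * min (h (X (enn2real (T \<omega>)) \<omega>)) (h b)) \<partial>P x) \<le> ennreal (h x)"
  unfolding h_martingale_until_hitting[OF assms, symmetric]
proof (rule nn_integral_mono_AE)
  let ?S = "\<lambda>\<omega>. min (T \<omega>) (first_time X {b..} \<omega>)"
  show "AE \<omega> in P x. ennreal (discount q (T \<omega>) * min (h (X (enn2real (T \<omega>)) \<omega>)) (h b)) \<le>
      ennreal (discount q (?S \<omega>) * h (X (enn2real (?S \<omega>)) \<omega>))"
    using AE_hitting[OF x b xb]
  proof (eventually_elim, intro ennreal_leI)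
    fix \<omega> assume hit: "first_time X {b} \<omega> = first_time X {b..} \<omega> \<and>
      (first_time X {b..} \<omega> < \<infinity> \<longrightarrow> X (enn2real (first_time X {b..} \<omega>)) \<omega> = b)"
    show "discount q (T \<omega>) * min (h (X (enn2real (T \<omega>)) \<omega>)) (h b) \<le>
      discount q (?S \<omega>) * h (X (enn2real (?S \<omega>)) \<omega>)"
    proof (cases "T \<omega> \<le> first_time X {b..} \<omega>")
      case True
      then show ?thesis by (auto simp: min_def intro: mult_left_mono)
    next
      case False
      then have lt: "first_time X {b..} \<omega> < T \<omega>" by simp
      then have "first_time X {b..} \<omega> < \<infinity>" by (auto intro: less_le_trans)
      moreover have S: "?S \<omega> = first_time X {b..} \<omega>" using lt by (simp add: min.absorb2 less_imp_le)
      ultimately have X: "X (enn2real (?S \<omega>)) \<omega> = b" using hit by simp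
      have "discount q (T \<omega>) * min (h (X (enn2real (T \<omega>)) \<omega>)) (h b) \<le> discount q (T \<omega>) * h b"
        by (intro mult_left_mono) simp_all
      also have "\<dots> \<le> discount q (?S \<omega>) * h b"
        using h_pos[OF b] by (intro mult_right_mono discount_antimono q_pos) simp_all
      finally show ?thesis unfolding X .
    qed
  qed
qed

text \<open>Each level needs a point of \<open>E\<close> above it. If \<open>E\<close> has a
  maximum, the levels approach it from below and left continuity of \<open>h\<close> makes the
  truncations converge; if not, the levels eventually pass every point and each truncation becomes
  inactive.\<close>

lemma exhausting_levels:
  assumes x: "x \<in> E" and w: "w \<in> E" "x < w"
  obtains b :: "nat \<Rightarrow> real"
  where "\<And>n. b n \<in> E" "\<And>n. \<exists>w\<in>E. b n < w" "eventually (\<lambda>n. x \<le> b n) sequentially"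
    "\<And>y. y \<in> E \<Longrightarrow> (\<lambda>n. min (h y) (h (b n))) \<longlonglongrightarrow> h y"
proof (cases "\<exists>s\<in>E. \<forall>y\<in>E. y \<le> s")
  case True
  then obtain s where s: "s \<in> E" "\<And>y. y \<in> E \<Longrightarrow> y \<le> s" by blast
  have xs: "x < s" using s(2)[OF w(1)] w(2) by simp
  define b where "b n = s - (s - x) / real (Suc n)" for n
  have b: "x \<le> b n" "b n < s" for n
    using xs divide_left_mono[of 1 "real (Suc n)" "s - x"] by (auto simp: b_def)
  have bE: "b n \<in> E" for n
    using mem_is_interval_1_I[OF interval(1) x s(1), of "b n"] b[of n] by auto
  have "(\<lambda>n. s - (s - x) * (1 / real (Suc n))) \<longlonglongrightarrow> s - (s - x) * 0"
    by (intro tendsto_intros LIMSEQ_Suc[OF lim_1_over_n])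
  then have "b \<longlonglongrightarrow> s" by (simp add: b_def[abs_def])
  then have hb: "(\<lambda>n. h (b n)) \<longlonglongrightarrow> h s"
    by (intro h_left_limit s bE less_imp_le[OF b(2)])
  have "(\<lambda>n. min (h y) (h (b n))) \<longlonglongrightarrow> h y" if y: "y \<in> E" for y
  proof -
    have "(\<lambda>n. min (h y) (h (b n))) \<longlonglongrightarrow> min (h y) (h s)" by (intro tendsto_min tendsto_const hb)
    then show ?thesis using h_mono[OF y s(1) s(2)[OF y]] by (simp add: min.absorb1)
  qed
  then show ?thesis using b bE s(1) by (intro that[of b]) auto
next
  case False
  \<comment> \<open>The supremum is taken in the extended reals so that an unbounded
    \<open>E\<close> needs no separate case.\<close>
  obtain f where f: "range f \<subseteq> ereal ` E" "incseq f" "Sup (ereal ` E) = (SUP i. f i)"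
    using Sup_countable_SUP[of "ereal ` E"] interval(2) by auto
  define b where "b n = real_of_ereal (f n)" for n
  have b: "b n \<in> E" "f n = ereal (b n)" for n
  proof -
    have "f n \<in> ereal ` E" using f(1) by auto
    then show "b n \<in> E" "f n = ereal (b n)" by (auto simp: b_def)
  qed
  have ev: "eventually (\<lambda>n. y \<le> b n) sequentially" if y: "y \<in> E" for y
  proof -
    obtain y' where y': "y' \<in> E" "y < y'" using False y by (auto simp: not_le)
    have "ereal y < ereal y'" using y' by simp
    also have "\<dots> \<le> (SUP i. f i)" unfolding f(3)[symmetric] using y' by (intro Sup_upper) auto
    finally obtain N where "ereal y < f N" by (auto simp: less_SUP_iff)
    then have "ereal y \<le> f n" if "N \<le> n" for n
      using f(2) that by (meson incseqD less_imp_le order_trans)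
    then show ?thesis by (intro eventually_sequentiallyI[of N]) (simp add: b)
  qed
  have "(\<lambda>n. min (h y) (h (b n))) \<longlonglongrightarrow> h y" if y: "y \<in> E" for y
  proof (rule tendsto_eventually)
    show "eventually (\<lambda>n. min (h y) (h (b n)) = h y) sequentially"
      using ev[OF y] by eventually_elim (simp add: h_mono[OF y b(1)] min.absorb1)
  qed
  then show ?thesis using b ev[OF x] False by (intro that[of b]) (auto simp: not_le)
qed

text \<open>At the maximum of \<open>E\<close> no higher level exists, but there \<open>h x\<close>
  bounds \<open>h\<close> on \<open>E\<close> and the discount is at most 1. Elsewhere Fatou's lemma
  removes the truncation; it asks neither for monotone levels nor for a bound at the finitely many
  levels below \<open>x\<close>.\<close>

lemma h_superharmonic:
  assumes x: "x \<in> E" and T: "stopping_time F T"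
  shows "(\<integral>\<^sup>+\<omega>. ennreal (discount q (T \<omega>) * h (X (enn2real (T \<omega>)) \<omega>)) \<partial>P x) \<le> ennreal (h x)"
proof (cases "\<exists>w\<in>E. x < w")
  case False
  interpret prob_space "P x" by (rule prob_P[OF x])
  have "(\<integral>\<^sup>+\<omega>. ennreal (discount q (T \<omega>) * h (X (enn2real (T \<omega>)) \<omega>)) \<partial>P x) \<le> (\<integral>\<^sup>+\<omega>. ennreal (h x) \<partial>P x)"
  proof (intro nn_integral_mono ennreal_leI)
    fix \<omega> assume "\<omega> \<in> space (P x)"
    then have "X (enn2real (T \<omega>)) \<omega> \<in> E" by (intro range_X) (auto simp: space_P x)
    then have "0 < h (X (enn2real (T \<omega>)) \<omega>)" "h (X (enn2real (T \<omega>)) \<omega>) \<le> h x"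
      using False x by (auto intro!: h_mono h_pos simp: not_less)
    then have "discount q (T \<omega>) * h (X (enn2real (T \<omega>)) \<omega>) \<le> 1 * h x"
      by (intro mult_mono discount_le_1 q_pos) auto
    then show "discount q (T \<omega>) * h (X (enn2real (T \<omega>)) \<omega>) \<le> h x" by simp
  qed
  then show ?thesis by (simp add: emeasure_space_1)
next
  case True
  then obtain w where w: "w \<in> E" "x < w" by blast
  obtain b :: "nat \<Rightarrow> real" where b: "\<And>n. b n \<in> E" "\<And>n. \<exists>w\<in>E. b n < w"
    "eventually (\<lambda>n. x \<le> b n) sequentially"
    "\<And>y. y \<in> E \<Longrightarrow> (\<lambda>n. min (h y) (h (b n))) \<longlonglongrightarrow> h y"
    using exhausting_levels[OF x w] by blast
  let ?g = "\<lambda>n \<omega>. ennreal (discount q (T \<omega>) * min (h (X (enn2real (T \<omega>)) \<omega>)) (h (b n)))"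
  have m: "?g n \<in> borel_measurable (P x)" for n
    by (intro measurable_compose[OF measurable_stopped[where f = "\<lambda>y. min (h y) (h (b n))"] measurable_ennreal]
        borel_measurable_min borel_measurable_const h_measurable measurable_T T x)
  have "(\<integral>\<^sup>+\<omega>. ennreal (discount q (T \<omega>) * h (X (enn2real (T \<omega>)) \<omega>)) \<partial>P x) =
      (\<integral>\<^sup>+\<omega>. liminf (\<lambda>n. ?g n \<omega>) \<partial>P x)"
  proof (rule nn_integral_cong)
    fix \<omega> assume "\<omega> \<in> space (P x)"
    then have E: "X (enn2real (T \<omega>)) \<omega> \<in> E" by (intro range_X) (auto simp: space_P x)
    have "(\<lambda>n. ?g n \<omega>) \<longlonglongrightarrow> ennreal (discount q (T \<omega>) * h (X (enn2real (T \<omega>)) \<omega>))"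
      by (intro tendsto_ennrealI tendsto_mult tendsto_const b E)
    then show "ennreal (discount q (T \<omega>) * h (X (enn2real (T \<omega>)) \<omega>)) = liminf (\<lambda>n. ?g n \<omega>)"
      by (intro lim_imp_Liminf[symmetric]) simp_all
  qed
  also have "\<dots> \<le> liminf (\<lambda>n. \<integral>\<^sup>+\<omega>. ?g n \<omega> \<partial>P x)"
    by (rule nn_integral_liminf[OF m])
  also have "\<dots> \<le> liminf (\<lambda>n. ennreal (h x))"
  proof (rule Liminf_mono)
    show "\<forall>\<^sub>F n in sequentially. (\<integral>\<^sup>+\<omega>. ?g n \<omega> \<partial>P x) \<le> ennreal (h x)"
      using b(3)
    proof eventually_elim
      case (elim n)
      obtain w where "w \<in> E" "b n < w" using b(2) by blast
      then show ?case by (intro h_truncated_superharmonic[OF x b(1) elim _ _ T])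
    qed
  qed
  also have "\<dots> = ennreal (h x)" by (intro lim_imp_Liminf) auto
  finally show ?thesis .
qed

section \<open>The stopping problem\<close>

text \<open>The cost up to \<open>T\<close> is the total cost minus the tail, and the tail has the
  expectation of the discounted \<open>\<delta>\<close> at the stopped position. Superharmonicity of
  \<open>h\<close> comes in twice: the integrable bound \<open>D * h\<close> dominates the two
  nonnegative parts of \<open>V\<close> separately, and then it bounds the expectation of
  \<open>V\<close>.\<close>

lemma payoff_integral:
  assumes g: "continuous_on E g" "\<And>y. y \<in> E \<Longrightarrow> 0 \<le> g y"
    and c: "continuous_on E c" "\<And>y. y \<in> E \<Longrightarrow> 0 \<le> c y"
    and fin: "\<And>y. y \<in> E \<Longrightarrow> total_cost P X q c y < \<infinity>"
    and \<delta>: "\<And>y. y \<in> E \<Longrightarrow> \<delta> y = enn2real (total_cost P X q c y)"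
    and x: "x \<in> E" and D: "\<And>u. u \<in> E \<Longrightarrow> g u + \<delta> u \<le> D * h u"
    and T: "stopping_time F T"
  defines "V \<equiv> \<lambda>\<omega>. discount q (T \<omega>) * (g (X (enn2real (T \<omega>)) \<omega>) + \<delta> (X (enn2real (T \<omega>)) \<omega>))"
  shows "integrable (P x) (payoff X q g c T)" "integrable (P x) V"
    "(\<integral>\<omega>. payoff X q g c T \<omega> \<partial>P x) = (\<integral>\<omega>. V \<omega> \<partial>P x) - \<delta> x"
    "(\<integral>\<omega>. V \<omega> \<partial>P x) \<le> D * h x"
proof -
  have \<delta>0: "0 \<le> \<delta> y" and \<delta>E: "ennreal (\<delta> y) = total_cost P X q c y" if "y \<in> E" for y
    using fin[OF that] \<delta>[OF that] by simp_all
  \<comment> \<open>The sign is needed to multiply the superharmonic inequality by \<open>D\<close>;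
    it follows from \<open>g\<close> and \<open>\<delta>\<close> being nonnegative and
    \<open>h\<close> positive.\<close>
  have D0: "0 \<le> D"
  proof -
    have "0 \<le> D * h x" using D[OF x] g(2)[OF x] \<delta>0[OF x] by linarith
    then show ?thesis using h_pos[OF x] by (simp add: zero_le_mult_iff)
  qed
  define Y where "Y \<omega> = X (enn2real (T \<omega>)) \<omega>" for \<omega>
  have Y: "Y \<omega> \<in> E" if "\<omega> \<in> space (P x)" for \<omega>
    unfolding Y_def using that by (intro range_X) (auto simp: space_P x)
  note mT[measurable] = measurable_T[OF T]
  have mc: "c \<in> borel_measurable borel_E" by (rule borel_measurable_continuous_on_restrict[OF c(1)])
  have mg: "g \<in> borel_measurable borel_E" by (rule borel_measurable_continuous_on_restrict[OF g(1)])
  have "(\<lambda>y. enn2real (total_cost P X q c y)) \<in> borel_measurable borel_E"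
    using total_cost_measurable[OF q_pos c] by measurable
  then have m\<delta>: "\<delta> \<in> borel_measurable borel_E"
    by (rule measurable_cong[THEN iffD2, rotated]) (simp add: \<delta>)
  let ?g = "\<lambda>\<omega>. discount q (T \<omega>) * g (Y \<omega>)" and ?d = "\<lambda>\<omega>. discount q (T \<omega>) * \<delta> (Y \<omega>)"
    and ?k = "\<lambda>\<omega>. enn2real (cost X q c (T \<omega>) \<omega>)"
  have m: "?g \<in> borel_measurable (P x)" "?d \<in> borel_measurable (P x)"
    "(\<lambda>\<omega>. discount q (T \<omega>) * h (Y \<omega>)) \<in> borel_measurable (P x)"
    unfolding Y_def by (intro measurable_stopped mg m\<delta> h_measurable mT x)+
  have mcost: "(\<lambda>\<omega>. cost X q c (T \<omega>) \<omega>) \<in> borel_measurable (P x)"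
    and mtail: "(\<lambda>\<omega>. tail_cost X q c (T \<omega>) \<omega>) \<in> borel_measurable (P x)"
    by (intro measurable_P_borel measurable_path_cost mc mT x)+
  have V: "V \<omega> = ?g \<omega> + ?d \<omega>" for \<omega> unfolding V_def Y_def by (simp add: distrib_left)
  have ih: "integrable (P x) (\<lambda>\<omega>. discount q (T \<omega>) * h (Y \<omega>))"
    and Ih: "(\<integral>\<omega>. discount q (T \<omega>) * h (Y \<omega>) \<partial>P x) \<le> h x"
  proof -
    have le: "(\<integral>\<^sup>+\<omega>. ennreal (discount q (T \<omega>) * h (Y \<omega>)) \<partial>P x) \<le> ennreal (h x)"
      unfolding Y_def by (rule h_superharmonic[OF x T])
    have ae: "AE \<omega> in P x. 0 \<le> discount q (T \<omega>) * h (Y \<omega>)"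
      by (intro AE_I2 mult_nonneg_nonneg discount_nonneg less_imp_le[OF h_pos] Y)
    show i: "integrable (P x) (\<lambda>\<omega>. discount q (T \<omega>) * h (Y \<omega>))"
      by (rule integrableI_nonneg[OF m(3) ae]) (use le in \<open>auto intro: le_less_trans\<close>)
    show "(\<integral>\<omega>. discount q (T \<omega>) * h (Y \<omega>) \<partial>P x) \<le> h x"
      using le h_pos[OF x] unfolding nn_integral_eq_integral[OF i ae] by simp
  qed
  have Vle: "V \<omega> \<le> D * (discount q (T \<omega>) * h (Y \<omega>))" if "\<omega> \<in> space (P x)" for \<omega>
  proof -
    have "V \<omega> \<le> discount q (T \<omega>) * (D * h (Y \<omega>))"
      unfolding V_def Y_def[symmetric] by (intro mult_left_mono D Y that) simp
    then show ?thesis by (simp add: mult_ac)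
  qed
  have nonneg: "0 \<le> ?g \<omega>" "0 \<le> ?d \<omega>" if "\<omega> \<in> space (P x)" for \<omega>
    using g(2)[OF Y[OF that]] \<delta>0[OF Y[OF that]] by simp_all
  have iDh: "integrable (P x) (\<lambda>\<omega>. D * (discount q (T \<omega>) * h (Y \<omega>)))"
    using ih by (rule integrable_mult_right)
  have ig: "integrable (P x) ?g" and id: "integrable (P x) ?d"
  proof -
    have "norm (?g \<omega>) \<le> norm (D * (discount q (T \<omega>) * h (Y \<omega>)))"
      "norm (?d \<omega>) \<le> norm (D * (discount q (T \<omega>) * h (Y \<omega>)))" if "\<omega> \<in> space (P x)" for \<omega>
      using Vle[OF that] nonneg[OF that] unfolding V real_norm_def by linarith+
    then show "integrable (P x) ?g" "integrable (P x) ?d"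
      by (auto intro: Bochner_Integration.integrable_bound[OF iDh] m)
  qed
  have ik: "integrable (P x) ?k" and sum: "(\<integral>\<omega>. ?k \<omega> \<partial>P x) + (\<integral>\<omega>. ?d \<omega> \<partial>P x) = \<delta> x"
  proof -
    have tail: "(\<integral>\<^sup>+\<omega>. tail_cost X q c (T \<omega>) \<omega> \<partial>P x) = ennreal (\<integral>\<omega>. ?d \<omega> \<partial>P x)"
    proof -
      have "(\<integral>\<^sup>+\<omega>. tail_cost X q c (T \<omega>) \<omega> \<partial>P x) =
          (\<integral>\<^sup>+\<omega>. ennreal (discount q (T \<omega>)) * total_cost P X q c (Y \<omega>) \<partial>P x)"
        unfolding Y_def by (rule strong_markov[OF q_pos c T x])
      also have "\<dots> = (\<integral>\<^sup>+\<omega>. ennreal (?d \<omega>) \<partial>P x)"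
        by (intro nn_integral_cong) (simp add: ennreal_mult \<delta>0 Y \<delta>E)
      also have "\<dots> = ennreal (\<integral>\<omega>. ?d \<omega> \<partial>P x)"
        by (intro nn_integral_eq_integral id AE_I2 nonneg)
      finally show ?thesis .
    qed
    have tot: "(\<integral>\<^sup>+\<omega>. cost X q c (T \<omega>) \<omega> \<partial>P x) + (\<integral>\<^sup>+\<omega>. tail_cost X q c (T \<omega>) \<omega> \<partial>P x) = ennreal (\<delta> x)"
    proof -
      have "(\<integral>\<^sup>+\<omega>. cost X q c (T \<omega>) \<omega> \<partial>P x) + (\<integral>\<^sup>+\<omega>. tail_cost X q c (T \<omega>) \<omega> \<partial>P x) =
          (\<integral>\<^sup>+\<omega>. cost X q c (T \<omega>) \<omega> + tail_cost X q c (T \<omega>) \<omega> \<partial>P x)"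
        by (rule nn_integral_add[symmetric, OF mcost mtail])
      also have "\<dots> = total_cost P X q c x"
        unfolding total_cost_def by (intro nn_integral_cong cost_add_tail_cost mc) (simp add: space_P x)
      finally show ?thesis by (simp add: \<delta>E x)
    qed
    \<comment> \<open>Finiteness of \<open>\<delta> x\<close> makes the cost finite almost surely,
      so \<open>enn2real\<close> in the payoff loses nothing under the integral.\<close>
    have fink: "(\<integral>\<^sup>+\<omega>. cost X q c (T \<omega>) \<omega> \<partial>P x) \<noteq> \<infinity>" using tot by auto
    then have ae: "AE \<omega> in P x. cost X q c (T \<omega>) \<omega> \<noteq> \<infinity>"
      by (rule nn_integral_PInf_AE[OF mcost])
    have eqk: "(\<integral>\<^sup>+\<omega>. ennreal (?k \<omega>) \<partial>P x) = (\<integral>\<^sup>+\<omega>. cost X q c (T \<omega>) \<omega> \<partial>P x)"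
    proof (rule nn_integral_cong_AE)
      show "AE \<omega> in P x. ennreal (?k \<omega>) = cost X q c (T \<omega>) \<omega>"
        using ae by eventually_elim (simp add: less_top)
    qed
    show ik: "integrable (P x) ?k"
      using mcost fink eqk by (intro integrableI_nonneg) (auto simp: less_top)
    have "ennreal (\<integral>\<omega>. ?k \<omega> \<partial>P x) + ennreal (\<integral>\<omega>. ?d \<omega> \<partial>P x) = ennreal (\<delta> x)"
      using tot unfolding tail eqk[symmetric] by (subst (asm) nn_integral_eq_integral[OF ik]) auto
    moreover have "0 \<le> (\<integral>\<omega>. ?k \<omega> \<partial>P x)" "0 \<le> (\<integral>\<omega>. ?d \<omega> \<partial>P x)"
      by (auto intro!: Bochner_Integration.integral_nonneg nonneg)
    ultimately show "(\<integral>\<omega>. ?k \<omega> \<partial>P x) + (\<integral>\<omega>. ?d \<omega> \<partial>P x) = \<delta> x"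
      using \<delta>0[OF x] by (simp add: ennreal_plus[symmetric] del: ennreal_plus)
  qed
  have pay: "payoff X q g c T = (\<lambda>\<omega>. ?g \<omega> - ?k \<omega>)"
    unfolding payoff_def Y_def by (rule ext) simp
  show "integrable (P x) (payoff X q g c T)" unfolding pay using ig ik by simp
  show iV: "integrable (P x) V" unfolding V[abs_def] using ig id by simp
  show "(\<integral>\<omega>. payoff X q g c T \<omega> \<partial>P x) = (\<integral>\<omega>. V \<omega> \<partial>P x) - \<delta> x"
    unfolding pay V[abs_def] sum[symmetric] using ig ik id by simp
  have "(\<integral>\<omega>. V \<omega> \<partial>P x) \<le> (\<integral>\<omega>. D * (discount q (T \<omega>) * h (Y \<omega>)) \<partial>P x)"
    by (rule integral_mono[OF iV iDh Vle])
  also have "\<dots> \<le> D * h x" using Ih D0 by (simp add: mult_left_mono)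
  finally show "(\<integral>\<omega>. V \<omega> \<partial>P x) \<le> D * h x" .
qed

text \<open>On finite entrance times the position is \<open>u\<close>, so the reward is the constant
  \<open>f u\<close>; on infinite ones the discount is 0 and the position is irrelevant.\<close>

lemma first_time_value:
  assumes x: "x \<in> E" and u: "u \<in> E" and xu: "x \<le> u"
    and i: "integrable (P x) (\<lambda>\<omega>. discount q (first_time X {u..} \<omega>) *
      f (X (enn2real (first_time X {u..} \<omega>)) \<omega>))"
  shows "(\<integral>\<omega>. discount q (first_time X {u..} \<omega>) * f (X (enn2real (first_time X {u..} \<omega>)) \<omega>) \<partial>P x) =
    f u / h u * h x"
proof -
  have m: "(\<lambda>\<omega>. discount q (first_time X {u..} \<omega>)) \<in> borel_measurable (P x)"
    using measurable_T[OF stopping_time_first_time[OF u]] by (intro measurable_P_borel x) measurable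
  have "(\<integral>\<omega>. discount q (first_time X {u..} \<omega>) * f (X (enn2real (first_time X {u..} \<omega>)) \<omega>) \<partial>P x) =
      (\<integral>\<omega>. discount q (first_time X {u..} \<omega>) * f u \<partial>P x)"
  proof (rule integral_cong_AE)
    show "AE \<omega> in P x. discount q (first_time X {u..} \<omega>) * f (X (enn2real (first_time X {u..} \<omega>)) \<omega>) =
        discount q (first_time X {u..} \<omega>) * f u"
      using AE_hitting[OF x u xu]
    proof eventually_elim
      case (elim \<omega>)
      show ?case
      proof (cases "first_time X {u..} \<omega>")
        case (real t)
        then have "first_time X {u..} \<omega> < \<infinity>" by simp
        then show ?thesis using elim by simp
      qed simp
    qed
  qed (use i m in auto)
  also have "\<dots> = f u / h u * h x"
    by (simp add: integral_discount_first_time x u xu)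
  finally show ?thesis .
qed

end

theorem theorem4p2:
  fixes M :: "'a measure" and F :: "ennreal \<Rightarrow> 'a measure"
    and E :: "real set" and P :: "real \<Rightarrow> 'a measure" and X :: "real \<Rightarrow> 'a \<Rightarrow> real"
    and q x D :: real and g c h \<delta> :: "real \<Rightarrow> real"
  assumes "feller_process M F E P X"
    and "regular_process E P X"
    and "spectrally_negative E P X"
    and "q > 0"
    and "continuous_on E g" and "\<And>y. y \<in> E \<Longrightarrow> 0 \<le> g y"
    and "continuous_on E c" and "\<And>y. y \<in> E \<Longrightarrow> 0 \<le> c y"
    and "\<And>y. y \<in> E \<Longrightarrow> total_cost P X q c y < \<infinity>"
    and "\<And>y. y \<in> E \<Longrightarrow> \<delta> y = enn2real (total_cost P X q c y)"
    and "increasing_q_function E P X q h"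
    and "x \<in> E"
    and "ereal D = (SUP u\<in>E. ereal ((g u + \<delta> u) / h u))"
    and "ereal D = (SUP u\<in>{u\<in>E. x \<le> u}. ereal ((g u + \<delta> u) / h u))"
  shows "(\<forall>T. stopping_time F T \<longrightarrow> integrable (P x) (payoff X q g c T)) \<and>
    (SUP T\<in>{T. stopping_time F T}. ereal (\<integral>\<omega>. payoff X q g c T \<omega> \<partial>P x)) = ereal (D * h x - \<delta> x) \<and>
    (\<forall>u\<in>E. x \<le> u \<longrightarrow> D = (g u + \<delta> u) / h u \<longrightarrow>
       stopping_time F (first_time X {u..}) \<and>
       ereal (\<integral>\<omega>. payoff X q g c (first_time X {u..}) \<omega> \<partial>P x) =
         (SUP T\<in>{T. stopping_time F T}. ereal (\<integral>\<omega>. payoff X q g c T \<omega> \<partial>P x)))"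
proof -
  interpret feller_process M F E P X by fact
  interpret spectrally_negative_process M F E P X q h
    by unfold_locales fact+
  note x = \<open>x \<in> E\<close>
  \<comment> \<open>Here the supremum over all of \<open>E\<close> is used, since a stopped position
    may be any point of \<open>E\<close>.\<close>
  have D: "g u + \<delta> u \<le> D * h u" if "u \<in> E" for u
  proof -
    have "ereal ((g u + \<delta> u) / h u) \<le> ereal D"
      unfolding assms(13) using that by (rule SUP_upper)
    then show ?thesis using h_pos[OF that] by (simp add: pos_divide_le_eq)
  qed
  note pay = payoff_integral[OF assms(5-10) x D]
  let ?E = "\<lambda>T. \<integral>\<omega>. payoff X q g c T \<omega> \<partial>P x"
  let ?S = "SUP T\<in>{T. stopping_time F T}. ereal (?E T)"
  have int: "integrable (P x) (payoff X q g c T)" and upper: "?E T \<le> D * h x - \<delta> x"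
    if "stopping_time F T" for T
    using pay[OF _ _ _ _ _ that] by simp_all
  have hit: "?E (first_time X {u..}) = (g u + \<delta> u) / h u * h x - \<delta> x" if u: "u \<in> E" "x \<le> u" for u
  proof -
    note S = stopping_time_first_time[OF u(1)]
    show ?thesis
      using pay(2,3)[OF _ _ _ _ _ S] first_time_value[OF x u, of "\<lambda>y. g y + \<delta> y"] by simp
  qed
  have "?S = ereal (D * h x - \<delta> x)"
  proof (rule antisym)
    show "?S \<le> ereal (D * h x - \<delta> x)"
      using upper by (intro SUP_least) simp
    \<comment> \<open>Entrance times give this value only for levels at or above the start, which is
      why the lower bound uses the supremum over \<open>u \<ge> x\<close>.\<close>
    have low: "ereal ((g u + \<delta> u) / h u * h x - \<delta> x) \<le> ?S" if u: "u \<in> E" "x \<le> u" for u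
      unfolding hit[OF u, symmetric] using stopping_time_first_time[OF u(1)] by (intro SUP_upper) simp
    show "ereal (D * h x - \<delta> x) \<le> ?S"
    \<comment> \<open>When \<open>?S\<close> is finite, the affine relation is solved for the ratio,
      so that \<open>D\<close> is bounded as a supremum of ratios; the level \<open>u = x\<close>
      excludes the value minus infinity.\<close>
    proof (cases ?S)
      case (real s)
      have "ereal ((g u + \<delta> u) / h u) \<le> ereal ((s + \<delta> x) / h x)" if u: "u \<in> {u \<in> E. x \<le> u}" for u
        using low[of u] u h_pos[OF x] unfolding real by (simp add: pos_le_divide_eq)
      then have "ereal D \<le> ereal ((s + \<delta> x) / h x)" unfolding assms(14) by (rule SUP_least)
      then show ?thesis using h_pos[OF x] unfolding real by (simp add: pos_le_divide_eq)
    next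
      case MInf
      then show ?thesis using low[OF x order_refl] by simp
    qed simp
  qed
  then show ?thesis using int hit stopping_time_first_time by auto
qed

end
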